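(* Let $A\in\{\mathbb{H},\mathbb{O}\}$, let $\Omega=\Omega_D^A$ be a basic domain and let $f=f_0+f_v\in\mathcal{S}(\Omega)$ be slice regular. Then there exist a fixed quaternionic subalgebra $\mathbb{H}_0=\operatorname{span}_{\mathbb{R}}\{1,i,j,k\}\subset A$, $k:=ij$, and slice-preserving functions $h_1,h_2\in\mathcal{S}_{\mathbb{R}}(\Omega)$ such that the slice regular function \[ f':=f_0+h_1 i+h_2 j \] is strongly equivalent to $f$.
   Context: $A$ is the algebra $\mathbb{H}$ of quaternions or $\mathbb{O}$ of octonions, with standard conjugation $x\mapsto x^c$; $n=\dim_{\mathbb{R}}A-1$, and $1,e_1,\dots,e_n$ is the standard orthonormal basis ($e_\ell^2=-1$). A quaternionic subalgebra $\operatorname{span}_{\mathbb{R}}\{1,i,j,k\}$ is one where $i,j\in A$ are orthogonal imaginary units ($i^2=j^2=-1$, $ij=-ji$) and $k=ij$. $\mathbb{S}_A=\{I\in A: I^2=-1\}$, $\mathbb{C}_I=\operatorname{span}_{\mathbb{R}}\{1,I\}$, $\mathbb{C}_I^+=\{x+yI:x\in\mathbb{R},y>0\}$. $A_{\mathbb{C}}=A\otimes_{\mathbb{R}}\mathbb{C}$, with elements $a+\sqrt{-1}\,b$ ($a,b\in A$), complex conjugation $\overline{a+\sqrt{-1}b}=a-\sqrt{-1}b$ and $(a+\sqrt{-1}b)^c=a^c+\sqrt{-1}b^c$. For a nonempty open $D\subset\mathbb{C}$ with $\overline D=D$ (invariant under complex conjugation), $\Omega_D^A=\{\alpha+\beta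 I:\alpha+\sqrt{-1}\beta\in D,\ I\in\mathbb{S}_A\}$; a circular domain is a connected set $\Omega$ of this form, and it is a basic domain if $\Omega\cap\mathbb{C}_J^+$ is simply connected for every $J\in\mathbb{S}_A$. A stem function is $F=F_1+\sqrt{-1}F_2:D\to A_{\mathbb{C}}$ with $F(\bar z)=\overline{F(z)}$. It induces $f=\mathcal{I}(F):\Omega_D^A\to A$, $f(\alpha+I\beta)=F_1(\alpha+\sqrt{-1}\beta)+I\,F_2(\alpha+\sqrt{-1}\beta)$; $f$ is slice regular if $F$ is holomorphic, and $\mathcal{S}(\Omega)$ is the set of slice regular functions. $\mathcal{I}(F)*\mathcal{I}(G)=\mathcal{I}(FG)$, $f^c=\mathcal{I}(F^c)$, $\operatorname{Tr}(f)=f+f^c$, $N(f)=f*f^c$. $f$ is slice preserving if $F$ is $\mathbb{C}$-valued; $\mathcal{S}_{\mathbb{R}}(\Omega)$ is the set of slice-preserving regular functions. Every $f\in\mathcal{S}(\Omega)$ is uniquely $f=f_0+\sum_{\ell=1}^n f_\ell e_\ell$ with $f_\ell=\mathcal{I}(F_\ell)\in\mathcal{S}_{\mathbb{R}}(\Omega)$; $f_v=\sum_{\ell\ge1}f_\ell e_\ell$ is its vector part. The central divisor $\operatorname{cdiv}(f)$ is the divisor $\sum_{p\in D}\min_{1\le\ell\le n}\operatorname{ord}_p(F_\ell)\,[p]$ on $D$ (orders are $+\infty$ everywhere if $f_v\equiv0$). Two functions $f,g\in\mathcal{S}(\Omega)$ are strongly equivalent if $\operatorname{Tr}(f)=\operatorname{Tr}(g)$,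 $N(f)=N(g)$ and $\operatorname{cdiv}(f)=\operatorname{cdiv}(g)$. *)

theory Defs
  imports "HOL-Complex_Analysis.Complex_Analysis" "HOL-Library.Extended_Nat"
begin

section \<open>Quaternions and octonions\<close>

text \<open>
  Both algebras are obtained from \<open>complex\<close> by Cayley-Dickson doubling. The type class is purely
  syntactic: it provides the product, the unit, the conjugation \<open>x\<^sup>c\<close>, and (through
  \<^class>\<open>euclidean_space\<close>) the standard orthonormal basis \<open>Basis\<close>, which contains \<open>1\<close>. So
  \<open>e\<^sub>1, \<dots>, e\<^sub>n\<close> are the elements of \<open>Basis - {1}\<close>.
\<close>

class hypercomplex = euclidean_space + one + times +
  fixes hconj :: "'a \<Rightarrow> 'a"

instantiation complex :: hypercomplex
begin
definition hconj_complex :: "complex \<Rightarrow> complex" where "hconj_complex = cnj"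
instance ..
end

datatype 'a cd = CD (cd_fst: 'a) (cd_snd: 'a)

instantiation cd :: (real_vector) real_vector
begin
definition zero_cd :: "'a cd" where "0 = CD 0 0"
definition plus_cd :: "'a cd \<Rightarrow> 'a cd \<Rightarrow> 'a cd" where
  "x + y = CD (cd_fst x + cd_fst y) (cd_snd x + cd_snd y)"
definition minus_cd :: "'a cd \<Rightarrow> 'a cd \<Rightarrow> 'a cd" where
  "x - y = CD (cd_fst x - cd_fst y) (cd_snd x - cd_snd y)"
definition uminus_cd :: "'a cd \<Rightarrow> 'a cd" where
  "- x = CD (- cd_fst x) (- cd_snd x)"
definition scaleR_cd :: "real \<Rightarrow> 'a cd \<Rightarrow> 'a cd" where
  "r *\<^sub>R x = CD (r *\<^sub>R cd_fst x) (r *\<^sub>R cd_snd x)"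
instance
  by standard
    (simp_all add: zero_cd_def plus_cd_def minus_cd_def uminus_cd_def scaleR_cd_def
      algebra_simps)
end

lemma cd_sel_simps [simp]:
  "cd_fst 0 = 0" "cd_snd 0 = 0"
  "cd_fst (x + y) = cd_fst x + cd_fst y" "cd_snd (x + y) = cd_snd x + cd_snd y"
  "cd_fst (x - y) = cd_fst x - cd_fst y" "cd_snd (x - y) = cd_snd x - cd_snd y"
  "cd_fst (- x) = - cd_fst x" "cd_snd (- x) = - cd_snd x"
  "cd_fst (r *\<^sub>R x) = r *\<^sub>R cd_fst x" "cd_snd (r *\<^sub>R x) = r *\<^sub>R cd_snd x"
  by (simp_all add: zero_cd_def plus_cd_def minus_cd_def uminus_cd_def scaleR_cd_def)

instantiation cd :: (real_inner) real_inner
begin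
definition inner_cd :: "'a cd \<Rightarrow> 'a cd \<Rightarrow> real" where
  "inner_cd x y = inner (cd_fst x) (cd_fst y) + inner (cd_snd x) (cd_snd y)"
definition norm_cd :: "'a cd \<Rightarrow> real" where
  "norm_cd x = sqrt (inner x x)"
definition sgn_cd :: "'a cd \<Rightarrow> 'a cd" where
  "sgn_cd x = x /\<^sub>R norm x"
definition dist_cd :: "'a cd \<Rightarrow> 'a cd \<Rightarrow> real" where
  "dist_cd x y = norm (x - y)"
definition uniformity_cd :: "('a cd \<times> 'a cd) filter" where
  "uniformity_cd = (INF e\<in>{0 <..}. principal {(x, y). dist x y < e})"
definition open_cd :: "'a cd set \<Rightarrow> bool" where
  "open_cd U \<longleftrightarrow> (\<forall>x\<in>U. eventually (\<lambda>(x', y). x' = x \<longrightarrow> y \<in> U) uniformity)"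
instance
proof
  fix x y z :: "'a cd" and r :: real
  show "dist x y = norm (x - y)" "sgn x = x /\<^sub>R norm x"
    by (fact dist_cd_def sgn_cd_def)+
  show "uniformity = (INF e\<in>{0 <..}. principal {(x, y :: 'a cd). dist x y < e})"
    by (fact uniformity_cd_def)
  show "open U \<longleftrightarrow> (\<forall>x\<in>U. eventually (\<lambda>(x', y). x' = x \<longrightarrow> y \<in> U) uniformity)"
    for U :: "'a cd set" by (fact open_cd_def)
  show "inner x y = inner y x"
    by (simp add: inner_cd_def inner_commute)
  show "inner (x + y) z = inner x z + inner y z"
    by (simp add: inner_cd_def inner_add_left)
  show "inner (r *\<^sub>R x) y = r * inner x y"
    by (simp add: inner_cd_def distrib_left)
  show "0 \<le> inner x x"
    by (simp add: inner_cd_def)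
  show "inner x x = 0 \<longleftrightarrow> x = 0"
    by (simp add: inner_cd_def add_nonneg_eq_0_iff zero_cd_def) (metis cd.collapse cd.sel)
  show "norm x = sqrt (inner x x)"
    by (fact norm_cd_def)
qed
end

instantiation cd :: (euclidean_space) euclidean_space
begin
definition Basis_cd :: "'a cd set" where
  "Basis_cd = (\<lambda>b. CD b 0) ` Basis \<union> (\<lambda>b. CD 0 b) ` Basis"
instance
proof
  show "(Basis :: 'a cd set) \<noteq> {}" "finite (Basis :: 'a cd set)"
    by (auto simp: Basis_cd_def)
  show "inner u v = (if u = v then 1 else 0)" if "u \<in> Basis" "v \<in> Basis" for u v :: "'a cd"
    using that by (auto simp: Basis_cd_def inner_cd_def inner_Basis split: if_splits)
  show "(\<forall>u\<in>Basis. inner x u = 0) \<longleftrightarrow> x = 0" for x :: "'a cd"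
    by (cases x) (auto simp: Basis_cd_def inner_cd_def ball_Un euclidean_all_zero_iff zero_cd_def)
qed
end

instantiation cd :: (hypercomplex) hypercomplex
begin
definition one_cd :: "'a cd" where "1 = CD 1 0"
definition times_cd :: "'a cd \<Rightarrow> 'a cd \<Rightarrow> 'a cd" where
  "x * y = CD (cd_fst x * cd_fst y - hconj (cd_snd y) * cd_snd x)
              (cd_snd y * cd_fst x + cd_snd x * hconj (cd_fst y))"
definition hconj_cd :: "'a cd \<Rightarrow> 'a cd" where
  "hconj x = CD (hconj (cd_fst x)) (- cd_snd x)"
instance ..
end

type_synonym quat = "complex cd"
type_synonym octo = "quat cd"

definition imag_units :: "'a::hypercomplex set" where
  "imag_units = {I. I * I = - 1}"

definition quaternionic_frame :: "'a::hypercomplex set \<Rightarrow> 'a \<Rightarrow> 'a \<Rightarrow> bool" where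
  "quaternionic_frame H0 i j \<longleftrightarrow>
     i \<in> imag_units \<and> j \<in> imag_units \<and> inner i j = 0 \<and> i * j = - (j * i) \<and>
     H0 = span {1, i, j, i * j}"


section \<open>Circular domains\<close>

definition upper_half_slice :: "'a::hypercomplex \<Rightarrow> 'a set" where
  "upper_half_slice J = {x *\<^sub>R 1 + y *\<^sub>R J | x y. y > 0}"

definition conj_invariant_open :: "complex set \<Rightarrow> bool" where
  "conj_invariant_open D \<longleftrightarrow> open D \<and> D \<noteq> {} \<and> cnj ` D = D"

definition circularization :: "complex set \<Rightarrow> 'a::hypercomplex set" where
  "circularization D = {\<alpha> *\<^sub>R 1 + \<beta> *\<^sub>R I | \<alpha> \<beta> I. Complex \<alpha> \<beta> \<in> D \<and> I \<in> imag_units}"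

definition circular_domain :: "'a::hypercomplex set \<Rightarrow> bool" where
  "circular_domain \<Omega> \<longleftrightarrow>
     connected \<Omega> \<and> (\<exists>D. conj_invariant_open D \<and> \<Omega> = circularization D)"

definition basic_domain :: "'a::hypercomplex set \<Rightarrow> bool" where
  "basic_domain \<Omega> \<longleftrightarrow>
     circular_domain \<Omega> \<and> (\<forall>J\<in>imag_units. simply_connected (\<Omega> \<inter> upper_half_slice J))"


section \<open>The complexified algebra\<close>

text \<open>
  The element \<open>a + \<surd>-1 b\<close> of \<open>A \<otimes> \<complex>\<close> is encoded as the pair \<open>(a, b)\<close>, so that the real vector
  space structure and the topology are those of the product type.
\<close>

type_synonym 'a complexified = "'a \<times> 'a"

definition c_of_complex :: "complex \<Rightarrow> 'a::hypercomplex complexified" where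
  "c_of_complex z = (Re z *\<^sub>R 1, Im z *\<^sub>R 1)"

definition c_scale :: "complex \<Rightarrow> 'a::hypercomplex complexified \<Rightarrow> 'a complexified" where
  "c_scale z w = (Re z *\<^sub>R fst w - Im z *\<^sub>R snd w, Re z *\<^sub>R snd w + Im z *\<^sub>R fst w)"

definition c_mult ::
    "'a::hypercomplex complexified \<Rightarrow> 'a complexified \<Rightarrow> 'a complexified" where
  "c_mult v w = (fst v * fst w - snd v * snd w, fst v * snd w + snd v * fst w)"

definition c_bar :: "'a::hypercomplex complexified \<Rightarrow> 'a complexified" where
  "c_bar w = (fst w, - snd w)"

definition c_hconj :: "'a::hypercomplex complexified \<Rightarrow> 'a complexified" where
  "c_hconj w = (hconj (fst w), hconj (snd w))"

text \<open>Coordinate of \<open>w\<close> along \<open>b \<in> Basis\<close>, where \<open>Basis\<close> is a complex basis of \<open>A \<otimes> \<complex>\<close>.\<close>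

definition c_coord :: "'a::hypercomplex \<Rightarrow> 'a complexified \<Rightarrow> complex" where
  "c_coord b w = Complex (inner (fst w) b) (inner (snd w) b)"

text \<open>Complex differentiability, as \<^const>\<open>has_field_derivative\<close> but with values in \<open>A \<otimes> \<complex>\<close>.\<close>

definition c_holomorphic_on ::
    "(complex \<Rightarrow> 'a::hypercomplex complexified) \<Rightarrow> complex set \<Rightarrow> bool" where
  "c_holomorphic_on F D \<longleftrightarrow>
     (\<forall>z\<in>D. \<exists>w. (F has_derivative (\<lambda>h. c_scale h w)) (at z within D))"


section \<open>Slice functions\<close>

text \<open>
  Functions on \<open>\<Omega> = circularization D\<close> are total functions whose values outside \<open>\<Omega>\<close> are
  irrelevant; functions on \<open>D\<close> are treated likewise.
\<close>

definition stem_function ::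
    "complex set \<Rightarrow> (complex \<Rightarrow> 'a::hypercomplex complexified) \<Rightarrow> bool" where
  "stem_function D F \<longleftrightarrow> (\<forall>z\<in>D. F (cnj z) = c_bar (F z))"

text \<open>
  The function induced by \<open>F\<close>. When \<open>F\<close> is a stem function on \<open>D\<close>, the value at a point of
  \<open>circularization D\<close> does not depend on its representation as \<open>\<alpha> + \<beta> I\<close>.
\<close>

definition induced :: "(complex \<Rightarrow> 'a::hypercomplex complexified) \<Rightarrow> 'a \<Rightarrow> 'a" where
  "induced F x = (THE y. \<forall>\<alpha> \<beta> I. I \<in> imag_units \<and> x = \<alpha> *\<^sub>R 1 + \<beta> *\<^sub>R I \<longrightarrow>
     y = fst (F (Complex \<alpha> \<beta>)) + I * snd (F (Complex \<alpha> \<beta>)))"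

definition is_stem_of ::
    "complex set \<Rightarrow> (complex \<Rightarrow> 'a::hypercomplex complexified) \<Rightarrow> ('a \<Rightarrow> 'a) \<Rightarrow> bool" where
  "is_stem_of D F f \<longleftrightarrow> stem_function D F \<and> (\<forall>x\<in>circularization D. f x = induced F x)"

definition slice_regular :: "complex set \<Rightarrow> ('a::hypercomplex \<Rightarrow> 'a) set" where
  "slice_regular D = {f. \<exists>F. is_stem_of D F f \<and> c_holomorphic_on F D}"

text \<open>The values on \<open>D\<close> of a stem function of \<open>f\<close> are determined by \<open>f\<close>.\<close>

definition stem_of ::
    "complex set \<Rightarrow> ('a::hypercomplex \<Rightarrow> 'a) \<Rightarrow> complex \<Rightarrow> 'a complexified" where
  "stem_of D f = (SOME F. is_stem_of D F f)"

definition slice_times ::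
    "complex set \<Rightarrow> ('a::hypercomplex \<Rightarrow> 'a) \<Rightarrow> ('a \<Rightarrow> 'a) \<Rightarrow> 'a \<Rightarrow> 'a" where
  "slice_times D f g = induced (\<lambda>z. c_mult (stem_of D f z) (stem_of D g z))"

definition slice_conj :: "complex set \<Rightarrow> ('a::hypercomplex \<Rightarrow> 'a) \<Rightarrow> 'a \<Rightarrow> 'a" where
  "slice_conj D f = induced (\<lambda>z. c_hconj (stem_of D f z))"

definition slice_trace :: "complex set \<Rightarrow> ('a::hypercomplex \<Rightarrow> 'a) \<Rightarrow> 'a \<Rightarrow> 'a" where
  "slice_trace D f = (\<lambda>x. f x + slice_conj D f x)"

definition slice_norm :: "complex set \<Rightarrow> ('a::hypercomplex \<Rightarrow> 'a) \<Rightarrow> 'a \<Rightarrow> 'a" where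
  "slice_norm D f = slice_times D f (slice_conj D f)"

definition slice_preserving_regular :: "complex set \<Rightarrow> ('a::hypercomplex \<Rightarrow> 'a) set" where
  "slice_preserving_regular D =
     {f \<in> slice_regular D. \<forall>z\<in>D. stem_of D f z \<in> range c_of_complex}"

text \<open>
  \<open>stem_coord D f b\<close> is the complex-valued stem function \<open>F\<^sub>\<ell>\<close> for \<open>b = e\<^sub>\<ell>\<close>, and \<open>F\<^sub>0\<close> for \<open>b = 1\<close>.
\<close>

definition stem_coord ::
    "complex set \<Rightarrow> ('a::hypercomplex \<Rightarrow> 'a) \<Rightarrow> 'a \<Rightarrow> complex \<Rightarrow> complex" where
  "stem_coord D f b z = c_coord b (stem_of D f z)"

definition real_part :: "complex set \<Rightarrow> ('a::hypercomplex \<Rightarrow> 'a) \<Rightarrow> 'a \<Rightarrow> 'a" where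
  "real_part D f = induced (\<lambda>z. c_of_complex (stem_coord D f 1 z))"


section \<open>Central divisor and strong equivalence\<close>

definition holo_order :: "(complex \<Rightarrow> complex) \<Rightarrow> complex \<Rightarrow> enat" where
  "holo_order g p =
     (if eventually (\<lambda>z. g z = 0) (nhds p) then \<infinity> else enat (nat (zorder g p)))"

text \<open>A divisor is represented by its multiplicity function, extended by 0 outside \<open>D\<close>.\<close>

definition cdiv :: "complex set \<Rightarrow> ('a::hypercomplex \<Rightarrow> 'a) \<Rightarrow> complex \<Rightarrow> enat" where
  "cdiv D f p = (if p \<in> D
     then Min ((\<lambda>b. holo_order (stem_coord D f b) p) ` (Basis - {1})) else 0)"

definition strongly_equivalent ::
    "complex set \<Rightarrow> ('a::hypercomplex \<Rightarrow> 'a) \<Rightarrow> ('a \<Rightarrow> 'a) \<Rightarrow> bool" where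
  "strongly_equivalent D f g \<longleftrightarrow>
     (\<forall>x\<in>circularization D. slice_trace D f x = slice_trace D g x) \<and>
     (\<forall>x\<in>circularization D. slice_norm D f x = slice_norm D g x) \<and>
     cdiv D f = cdiv D g"

end

theory Submission
  imports Defs
begin

text \<open>
  Write \<open>F\<^sub>\<ell>\<close> for the components of the stem function of \<open>f\<^sub>v\<close>, \<open>G = \<Sum> F\<^sub>\<ell>\<^sup>2\<close> and \<open>d\<close> for the
  central divisor. Putting \<open>P = H\<^sub>1 + \<i> H\<^sub>2\<close> and \<open>P\<^sup>*(z) = cnj (P (cnj z))\<close>, one needs a holomorphic \<open>P\<close>
  on \<open>D\<close> with \<open>P P\<^sup>* = G\<close> such that the smaller of the orders of \<open>P\<close> and \<open>P\<^sup>*\<close> is \<open>d\<close> everywhere.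
  So \<open>P\<close> must have divisor \<open>ord G - d\<close> on one half of \<open>D\<close> and \<open>d\<close> on the other; on the real axis
  \<open>ord G = 2 d\<close>, because there \<open>G\<close> is a sum of squares of real functions. The Weierstrass theorem on
  the open set \<open>D\<close> gives \<open>W\<close> with this divisor. Then \<open>u = G / (W W\<^sup>*)\<close> has no zeros and is positive
  on the real axis, so its square root on the simply connected upper half of \<open>D\<close> extends to \<open>D\<close>
  by reflection to some \<open>s = s\<^sup>*\<close>, and \<open>P = W s\<close>. If \<open>G\<close> vanishes identically but \<open>f\<^sub>v\<close> does not,
  then \<open>D\<close> has no real points and \<open>P\<close> may be taken to be \<open>0\<close> on the upper half.
\<close>

section \<open>Orders of vanishing\<close>

text \<open>If H1 and H2 are symmetric, H(cnj z) = cnj (H z), then the reflection of P = H1 + \<i>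
  H2 is H1 - \<i> H2, so the product of the two is H1^2 + H2^2. The passage between the two pairs is
  an invertible linear change, so both have the same smaller order at each point. Trace and norm see
  a stem function only through F_0 and the sum of squares of all its components; keeping f_0
  therefore leaves exactly the two conditions on P. The product alone does not fix the central
  divisor: of two conjugate points one must carry order exactly d and the other all the rest. The
  obstacle is that only the upper half of D is simply connected: D may have holes crossed by the
  real axis (the punctured plane) or fall into two mirror halves. Hence the divisor is realized on
  all of D, so that W is holomorphic across the real axis, and a root is extracted only from the
  zero-free u. Positivity of u makes this root real on the real axis, with a sign that may change
  from one real interval to the next, and reality is all that reflection needs. The units i and j
  are two elements of the standard basis and do not depend on f.\<close>

lemma analytic_at_eventually_nonzero:
  fixes g :: "complex \<Rightarrow> complex"
  assumes "g analytic_on {p}" "g p \<noteq> 0"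
  shows "\<forall>\<^sub>F z in nhds p. g z \<noteq> 0"
proof -
  have "(g \<longlongrightarrow> g p) (at p)"
    using assms(1) by (simp add: analytic_at_imp_isCont isContD)
  from tendsto_imp_eventually_ne[OF this assms(2)] assms(2) show ?thesis
    by (simp add: eventually_nhds_conv_at)
qed

lemma holo_order_eqI:
  assumes "g analytic_on {p}" "g p \<noteq> 0" "\<forall>\<^sub>F z in nhds p. f z = (z - p) ^ n * g z"
  shows "holo_order f p = enat n"
proof -
  obtain S where S: "open S" "p \<in> S" "g holomorphic_on S"
    using assms(1) analytic_at by blast
  obtain T where T: "open T" "p \<in> T" "\<And>z. z \<in> T \<Longrightarrow> f z = (z - p) ^ n * g z"
    using assms(3) unfolding eventually_nhds by blast
  have "zorder f p = int n"
  proof (rule zorder_eqI)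
    show "open (S \<inter> T)" "p \<in> S \<inter> T" "g p \<noteq> 0" "g holomorphic_on S \<inter> T"
      using S T assms(2) by (auto intro: holomorphic_on_subset)
    show "f w = g w * (w - p) powi int n" if "w \<in> S \<inter> T" "w \<noteq> p" for w
      using that T(3)[of w] by simp
  qed
  moreover have "\<not> (\<forall>\<^sub>F z in nhds p. f z = 0)"
  proof
    assume "\<forall>\<^sub>F z in nhds p. f z = 0"
    moreover have "\<forall>\<^sub>F z in nhds p. g z \<noteq> 0"
      using assms(1,2) by (rule analytic_at_eventually_nonzero)
    \<comment> \<open>Absurd, because p is not an isolated point of the plane.\<close>
    ultimately have "\<forall>\<^sub>F z in nhds p. z = p"
      using assms(3) by eventually_elim auto
    hence "\<forall>\<^sub>F z in at p. False"
      unfolding eventually_at_filter by eventually_elim auto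
    thus False by simp
  qed
  ultimately show ?thesis
    by (simp add: holo_order_def)
qed

text \<open>Replaces \<open>zorder\<close>, which carries no information for a function vanishing
  near p, by a local factorization; the arguments on orders below rest on this case
  distinction.\<close>

lemma holo_order_cases:
  assumes "f analytic_on {p}"
  obtains (infinite) "holo_order f p = \<infinity>" "\<forall>\<^sub>F z in nhds p. f z = 0"
  | (finite) n g where "holo_order f p = enat n" "g analytic_on {p}" "g p \<noteq> 0"
      "\<forall>\<^sub>F z in nhds p. f z = (z - p) ^ n * g z"
proof (cases "\<forall>\<^sub>F z in nhds p. f z = 0")
  case True
  thus ?thesis by (intro that(1)) (auto simp: holo_order_def)
next
  case False
  obtain r where r: "r > 0" "f holomorphic_on ball p r"
    using assms unfolding analytic_on_def by blast
  have "\<exists>w\<in>ball p r. f w \<noteq> 0"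
  proof (rule ccontr)
    assume "\<not> (\<exists>w\<in>ball p r. f w \<noteq> 0)"
    hence "\<forall>\<^sub>F z in nhds p. f z = 0"
      using r(1) by (intro eventually_nhds_in_open[of "ball p r", THEN eventually_mono]) auto
    with False show False by blast
  qed
  have "p \<in> ball p r" using r(1) by simp
  from conjunct2[OF zorder_exist_zero[OF r(2) open_ball connected_ball this \<open>\<exists>w\<in>ball p r. f w \<noteq> 0\<close>]]
  obtain r' where r': "r' > 0" "zor_poly f p holomorphic_on cball p r'"
     "\<And>w. w \<in> cball p r' \<Longrightarrow> f w = zor_poly f p w * (w - p) ^ nat (zorder f p) \<and> zor_poly f p w \<noteq> 0"
    by blast
  have an: "zor_poly f p analytic_on {p}"
    using r'(1,2) unfolding analytic_on_def by (auto intro: holomorphic_on_subset[OF _ ball_subset_cball])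
  have nz: "zor_poly f p p \<noteq> 0" using r' by auto
  have ev: "\<forall>\<^sub>F z in nhds p. f z = (z - p) ^ nat (zorder f p) * zor_poly f p z"
  proof -
    have "\<forall>\<^sub>F z in nhds p. z \<in> ball p r'"
      using r'(1) by (intro eventually_nhds_in_open) auto
    thus ?thesis
    proof eventually_elim
      case (elim z)
      thus ?case using r'(3)[of z] by (simp add: mult.commute)
    qed
  qed
  show ?thesis
    by (rule that(2)[OF holo_order_eqI[OF an nz ev] an nz ev])
qed

lemma holo_order_cong:
  assumes "\<forall>\<^sub>F z in nhds p. f z = g z"
  shows "holo_order f p = holo_order g p"
proof -
  have "(\<forall>\<^sub>F z in nhds p. f z = 0) \<longleftrightarrow> (\<forall>\<^sub>F z in nhds p. g z = 0)"
    by (rule eventually_subst) (use assms in eventually_elim, simp)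
  moreover have "zorder f p = zorder g p"
    by (rule zorder_cong) (use assms in \<open>auto simp: eventually_nhds_conv_at\<close>)
  ultimately show ?thesis by (simp add: holo_order_def)
qed

lemma holo_order_eq_infinity_iff:
  "holo_order f p = \<infinity> \<longleftrightarrow> (\<forall>\<^sub>F z in nhds p. f z = 0)"
  by (simp add: holo_order_def)

text \<open>Lower bounds on the order are divisibility by a power of z - p among germs. In this form
  infinite order needs no separate treatment, and bounds for sums are immediate.\<close>

lemma le_holo_order_iff:
  assumes "f analytic_on {p}"
  shows "enat k \<le> holo_order f p \<longleftrightarrow>
    (\<exists>g. g analytic_on {p} \<and> (\<forall>\<^sub>F z in nhds p. f z = (z - p) ^ k * g z))"
  using assms
proof (cases rule: holo_order_cases)
  case infinite
  have "\<forall>\<^sub>F z in nhds p. f z = (z - p) ^ k * 0"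
    using infinite(2) by simp
  moreover have "(\<lambda>_. 0::complex) analytic_on {p}" by simp
  ultimately have "\<exists>g. g analytic_on {p} \<and> (\<forall>\<^sub>F z in nhds p. f z = (z - p) ^ k * g z)"
    by (intro exI[of _ "\<lambda>_. 0"] conjI)
  thus ?thesis using infinite(1) by simp
next
  case (finite n g)
  show ?thesis
  proof (cases "k \<le> n")
    case True
    have "(\<lambda>z. (z - p) ^ (n - k) * g z) analytic_on {p}"
      by (intro analytic_intros finite)
    moreover have "\<forall>\<^sub>F z in nhds p. f z = (z - p) ^ k * ((z - p) ^ (n - k) * g z)"
      using finite(4)
    proof eventually_elim
      case (elim z)
      have "(z - p) ^ n = (z - p) ^ k * (z - p) ^ (n - k)"
        using True by (simp flip: power_add)
      with elim show ?case by simp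
    qed
    ultimately have "\<exists>g. g analytic_on {p} \<and> (\<forall>\<^sub>F z in nhds p. f z = (z - p) ^ k * g z)"
      by (intro exI conjI)
    thus ?thesis using True finite(1) by simp
  next
    case False
    have "False" if h: "h analytic_on {p}" "\<forall>\<^sub>F z in nhds p. f z = (z - p) ^ k * h z" for h
    proof -
      have "\<forall>\<^sub>F z in at p. g z = (z - p) ^ (k - n) * h z"
        unfolding eventually_at_filter using h(2) finite(4)
      proof eventually_elim
        case (elim z)
        show ?case
        proof (intro impI)
          assume "z \<noteq> p"
          have "(z - p) ^ n * g z = (z - p) ^ n * ((z - p) ^ (k - n) * h z)"
          proof -
            have "(z - p) ^ k = (z - p) ^ n * (z - p) ^ (k - n)"
              using False by (simp flip: power_add)
            with elim show ?thesis by (simp only: mult.assoc)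
          qed
          thus "g z = (z - p) ^ (k - n) * h z" using \<open>z \<noteq> p\<close> by simp
        qed
      qed
      \<comment> \<open>The power (z - p)^n can be cancelled only off p, so the value at p has to be
        recovered as a limit; the surplus factor (z - p)^(k - n) makes it 0.\<close>
      from this have "((\<lambda>z. (z - p) ^ (k - n) * h z) \<longlongrightarrow> g p) (at p)"
        by (rule Lim_transform_eventually[rotated])
           (use finite(2) in \<open>simp add: analytic_at_imp_isCont isContD\<close>)
      moreover have "((\<lambda>z. (z - p) ^ (k - n) * h z) \<longlongrightarrow> (p - p) ^ (k - n) * h p) (at p)"
        using h(1) by (intro tendsto_intros) (simp add: analytic_at_imp_isCont isContD)
      ultimately have "g p = (p - p) ^ (k - n) * h p"
        by (rule LIM_unique)
      with False finite(3) show False by simp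
    qed
    hence "\<not> (\<exists>g. g analytic_on {p} \<and> (\<forall>\<^sub>F z in nhds p. f z = (z - p) ^ k * g z))"
      by blast
    with False finite(1) show ?thesis by simp
  qed
qed

lemma holo_order_mult:
  assumes "f analytic_on {p}" "g analytic_on {p}"
  shows "holo_order (\<lambda>z. f z * g z) p = holo_order f p + holo_order g p"
  using assms(1)
proof (cases rule: holo_order_cases)
  case infinite
  have "\<forall>\<^sub>F z in nhds p. f z * g z = 0"
    using infinite(2) by eventually_elim simp
  thus ?thesis using infinite(1) by (simp add: holo_order_eq_infinity_iff[THEN iffD2, of _ p])
next
  case f: (finite n f')
  show ?thesis using assms(2)
  proof (cases rule: holo_order_cases)
    case infinite
    have "\<forall>\<^sub>F z in nhds p. f z * g z = 0"
      using infinite(2) by eventually_elim simp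
    thus ?thesis using infinite(1) by (simp add: holo_order_eq_infinity_iff[THEN iffD2, of _ p])
  next
    case g: (finite m g')
    have "\<forall>\<^sub>F z in nhds p. f z * g z = (z - p) ^ (n + m) * (f' z * g' z)"
      using f(4) g(4) by eventually_elim (simp add: power_add)
    hence "holo_order (\<lambda>z. f z * g z) p = enat (n + m)"
      using f g by (intro holo_order_eqI[of "\<lambda>z. f' z * g' z"]) (auto intro!: analytic_intros)
    thus ?thesis using f g by simp
  qed
qed

lemma holo_order_add_ge:
  assumes "f analytic_on {p}" "g analytic_on {p}" "enat k \<le> holo_order f p" "enat k \<le> holo_order g p"
  shows "enat k \<le> holo_order (\<lambda>z. f z + g z) p"
proof -
  obtain f' where f': "f' analytic_on {p}" "\<forall>\<^sub>F z in nhds p. f z = (z - p) ^ k * f' z"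
    using assms le_holo_order_iff by blast
  obtain g' where g': "g' analytic_on {p}" "\<forall>\<^sub>F z in nhds p. g z = (z - p) ^ k * g' z"
    using assms le_holo_order_iff by blast
  have "\<forall>\<^sub>F z in nhds p. f z + g z = (z - p) ^ k * (f' z + g' z)"
    using f'(2) g'(2) by eventually_elim (simp add: algebra_simps)
  moreover have "(\<lambda>z. f' z + g' z) analytic_on {p}" 
    using f' g' by (intro analytic_intros)
  moreover have "(\<lambda>z. f z + g z) analytic_on {p}"
    using assms by (intro analytic_intros)
  ultimately show ?thesis
    using le_holo_order_iff by blast
qed

text \<open>No split on c = 0: orders add, and the order of a constant, finite or not, is
  nonnegative.\<close>

lemma holo_order_cmult_ge:
  assumes "f analytic_on {p}" "enat k \<le> holo_order f p"
  shows "enat k \<le> holo_order (\<lambda>z. c * f z) p"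
proof -
  have "holo_order (\<lambda>z. c * f z) p = holo_order (\<lambda>z. c) p + holo_order f p"
    by (intro holo_order_mult assms) auto
  also have "holo_order f p \<le> \<dots>" by simp
  finally show ?thesis using assms(2) by (rule order.trans[rotated])
qed

lemma holo_order_sum_ge:
  assumes "\<And>b. b \<in> B \<Longrightarrow> f b analytic_on {p}" "\<And>b. b \<in> B \<Longrightarrow> enat k \<le> holo_order (f b) p"
  shows "enat k \<le> holo_order (\<lambda>z. \<Sum>b\<in>B. f b z) p"
  using assms
proof (induction B rule: infinite_finite_induct)
  case (insert x F)
  have "enat k \<le> holo_order (\<lambda>z. f x z + (\<Sum>b\<in>F. f b z)) p"
    using insert by (intro holo_order_add_ge analytic_intros) auto
  thus ?case using insert by simp
qed (auto simp: holo_order_def)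

lemma holo_order_nonzero:
  assumes "f analytic_on {p}" "f p \<noteq> 0"
  shows "holo_order f p = 0"
  using holo_order_eqI[of f p f 0] assms by (simp add: zero_enat_def)

lemma holo_order_zero:
  assumes "f analytic_on {p}" "holo_order f p \<noteq> 0"
  shows "f p = 0"
  using assms holo_order_nonzero by blast

section \<open>Reflection in the real axis\<close>

text \<open>This is the \<open>P\<^sup>*\<close> of the overview: the two conjugations together
  preserve holomorphy, and the Taylor coefficients get conjugated.\<close>

definition cnj_conj :: "(complex \<Rightarrow> complex) \<Rightarrow> complex \<Rightarrow> complex" where
  "cnj_conj f z = cnj (f (cnj z))"

lemma cnj_conj_holomorphic:
  assumes "f holomorphic_on D" "open D" "cnj ` D = D"
  shows "cnj_conj f holomorphic_on D"
proof -
  have "cnj \<circ> f \<circ> cnj holomorphic_on D"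
    by (rule holomorphic_on_compose_cnj_cnj) (use assms in auto)
  thus ?thesis by (simp add: cnj_conj_def [abs_def] o_def)
qed

lemma eventually_nhds_cnj:
  "(\<forall>\<^sub>F z in nhds p. P (cnj z)) \<longleftrightarrow> (\<forall>\<^sub>F z in nhds (cnj p). P z)"
proof -
  have *: "\<forall>\<^sub>F z in nhds q. Q (cnj z)" if "\<forall>\<^sub>F z in nhds (cnj q). Q z" for q :: complex and Q
  proof -
    have "filterlim cnj (nhds (cnj q)) (nhds q)"
      by (rule tendsto_cnj[OF filterlim_ident])
    thus ?thesis using that by (auto simp: filterlim_iff)
  qed
  show ?thesis using *[of P p] *[of "\<lambda>z. P (cnj z)" "cnj p"] by auto
qed

lemma cnj_conj_analytic_at:
  assumes "f analytic_on {cnj p}"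
  shows "cnj_conj f analytic_on {p}"
proof -
  obtain e where e: "e > 0" "f holomorphic_on ball (cnj p) e"
    using assms unfolding analytic_on_def by auto
  have "dist (cnj x) (cnj y) = dist x y" for x y
    by (metis complex_cnj_diff complex_mod_cnj dist_norm)
  hence "cnj ` ball p e = ball (cnj p) e"
    unfolding image_cnj_conv_vimage_cnj set_eq_iff vimage_eq mem_ball
    by (metis complex_cnj_cnj)
  hence "cnj \<circ> f \<circ> cnj holomorphic_on ball p e"
    using e by (intro holomorphic_on_compose_cnj_cnj) auto
  hence "cnj_conj f holomorphic_on ball p e"
    by (simp add: cnj_conj_def [abs_def] o_def)
  thus ?thesis using e(1) by (auto simp: analytic_on_def)
qed

lemma holo_order_cnj_conj:
  assumes "f analytic_on {cnj p}"
  shows "holo_order (cnj_conj f) p = holo_order f (cnj p)"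
  using assms
proof (cases rule: holo_order_cases)
  case infinite
  have "\<forall>\<^sub>F z in nhds p. cnj_conj f z = 0"
    using infinite(2) unfolding cnj_conj_def
    by (simp add: eventually_nhds_cnj[of "\<lambda>z. f z = 0"])
  hence "holo_order (cnj_conj f) p = \<infinity>" by (simp only: holo_order_eq_infinity_iff)
  with infinite(1) show ?thesis by simp
next
  case (finite n g)
  have "\<forall>\<^sub>F z in nhds p. f (cnj z) = (cnj z - cnj p) ^ n * g (cnj z)"
    using finite(4) by (subst eventually_nhds_cnj)
  hence "\<forall>\<^sub>F z in nhds p. cnj_conj f z = (z - p) ^ n * cnj_conj g z"
    by eventually_elim (simp add: cnj_conj_def)
  hence "holo_order (cnj_conj f) p = enat n"
    by (intro holo_order_eqI[of "cnj_conj g"] cnj_conj_analytic_at finite)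
       (use finite in \<open>auto simp: cnj_conj_def\<close>)
  with finite show ?thesis by simp
qed

section \<open>Quotients, cancellation and zero sets\<close>

text \<open>At each point the equal powers of z - p cancel, and what remains is a quotient of two
  germs that do not vanish at p.\<close>

lemma holomorphic_quotient_same_order:
  assumes "open D" "f holomorphic_on D" "w holomorphic_on D"
  assumes "\<And>p. p \<in> D \<Longrightarrow> holo_order f p = holo_order w p" "\<And>p. p \<in> D \<Longrightarrow> holo_order w p \<noteq> \<infinity>"
  obtains u where "u holomorphic_on D" "\<And>p. p \<in> D \<Longrightarrow> u p \<noteq> 0" "\<And>p. p \<in> D \<Longrightarrow> f p = u p * w p"
proof -
  \<comment> \<open>At common zeros the plain quotient is a division by zero;
    \<open>remove_sings\<close> puts the limit there.\<close>
  define u where "u = remove_sings (\<lambda>z. f z / w z)"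
  have *: "u analytic_on {p} \<and> u p \<noteq> 0 \<and> f p = u p * w p" if p: "p \<in> D" for p
  proof -
    have an: "f analytic_on {p}" "w analytic_on {p}"
      using assms p analytic_at by blast+
    obtain n g h where gh: "g analytic_on {p}" "h analytic_on {p}" "g p \<noteq> 0" "h p \<noteq> 0"
       "\<forall>\<^sub>F z in nhds p. f z = (z - p) ^ n * g z" "\<forall>\<^sub>F z in nhds p. w z = (z - p) ^ n * h z"
      using an(1)
    proof (cases rule: holo_order_cases)
      case infinite
      thus ?thesis using assms(4,5)[OF p] by simp
    next
      case f: (finite n g)
      show ?thesis using an(2)
      proof (cases rule: holo_order_cases)
        case infinite
        thus ?thesis using assms(5)[OF p] by simp
      next
        case w: (finite m h)
        have "m = n" using f(1) w(1) assms(4)[OF p] by simp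
        with f w that show ?thesis by blast
      qed
    qed
    have an': "(\<lambda>z. g z / h z) analytic_on {p}"
      using gh by (intro analytic_intros) auto
    have hnz: "\<forall>\<^sub>F z in nhds p. h z \<noteq> 0"
      using gh(2,4) by (rule analytic_at_eventually_nonzero)
    have ev: "\<forall>\<^sub>F z in at p. f z / w z = g z / h z"
      unfolding eventually_at_filter using gh(5,6) by eventually_elim auto
    have ev2: "\<forall>\<^sub>F z in nhds p. u z = g z / h z"
    proof -
      \<comment> \<open>The value of \<open>remove_sings\<close> at z depends on the punctured
        neighbourhood of z, so the two quotients must be compared around every z near p, not only
        around p itself.\<close>
      have "\<forall>\<^sub>F z in nhds p. \<forall>\<^sub>F y in at z. f y / w y = g y / h y"
      proof -
        obtain S where S: "open S" "p \<in> S" "\<And>z. z \<in> S \<Longrightarrow> z \<noteq> p \<Longrightarrow> f z / w z = g z / h z"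
          using ev unfolding eventually_at_topological by blast
        have "\<forall>\<^sub>F y in at z. f y / w y = g y / h y" if "z \<in> S" for z
        proof (cases "z = p")
          case False
          have "\<forall>\<^sub>F y in nhds z. y \<in> S - {p}"
            using S that False by (intro eventually_nhds_in_open) auto
          hence "\<forall>\<^sub>F y in nhds z. f y / w y = g y / h y"
            by eventually_elim (use S in auto)
          thus ?thesis by (simp add: eventually_nhds_conv_at)
        qed (use ev in auto)
        thus ?thesis using eventually_nhds_in_open[OF S(1,2)] by (auto elim: eventually_mono)
      qed
      moreover have "\<forall>\<^sub>F z in nhds p. (\<lambda>z. g z / h z) analytic_on {z}"
      proof -
        obtain S where "open S" "p \<in> S" "(\<lambda>z. g z / h z) holomorphic_on S"
          using an' by (auto simp: analytic_at)
        thus ?thesis unfolding eventually_nhds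
          by (intro exI[of _ S]) (auto simp: analytic_at)
      qed
      ultimately show ?thesis
        by eventually_elim (simp add: u_def remove_sings_cong[OF _ refl])
    qed
    have up: "u p = g p / h p" using eventually_nhds_x_imp_x[OF ev2] .
    have "u analytic_on {p}" using an' analytic_at_cong[OF ev2 refl] by simp
    moreover have "u p \<noteq> 0" using up gh by simp
    moreover have "f p = u p * w p"
      using eventually_nhds_x_imp_x[OF gh(5)] eventually_nhds_x_imp_x[OF gh(6)] gh(4)
      by (simp add: up)
    ultimately show ?thesis by blast
  qed
  have "u holomorphic_on D"
    by (rule analytic_imp_holomorphic, subst analytic_on_analytic_at) (use * in blast)
  with * show ?thesis using that by blast
qed

lemma holo_order_eq_0_iff:
  assumes "f analytic_on {p}"
  shows "holo_order f p = 0 \<longleftrightarrow> f p \<noteq> 0"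
  using assms
proof (cases rule: holo_order_cases)
  case infinite
  thus ?thesis using eventually_nhds_x_imp_x[OF infinite(2)] by simp
next
  case (finite n g)
  have "f p = (p - p) ^ n * g p"
    using eventually_nhds_x_imp_x[OF finite(4)] .
  thus ?thesis using finite(1,3) by (cases "n = 0") (auto simp: zero_enat_def)
qed

lemma enat_leI:
  assumes "\<And>k. enat k \<le> x \<Longrightarrow> enat k \<le> y"
  shows "x \<le> y"
proof (cases y)
  case (enat m)
  have "\<not> enat (Suc m) \<le> y" using enat by simp
  hence "\<not> enat (Suc m) \<le> x" using assms by blast
  thus ?thesis unfolding enat by (cases x) simp_all
qed simp

lemma enat_eqI:
  assumes "\<And>k. enat k \<le> x \<longleftrightarrow> enat k \<le> y"
  shows "x = y"
proof (rule antisym)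
  show "x \<le> y" by (rule enat_leI) (simp add: assms)
  show "y \<le> x" by (rule enat_leI) (simp add: assms)
qed

text \<open>Germs at p form an integral domain: orders add, so a product with a factor of finite
  order is the zero germ only if the other factor is.\<close>

lemma holo_order_cancel:
  assumes "f analytic_on {p}" "g analytic_on {p}" "w analytic_on {p}" "holo_order w p \<noteq> \<infinity>"
    "\<forall>\<^sub>F z in nhds p. f z * w z = g z * w z"
  shows "f p = g p"
proof -
  have "\<forall>\<^sub>F z in nhds p. (f z - g z) * w z = 0"
    using assms(5) by eventually_elim (simp add: algebra_simps)
  hence "holo_order (\<lambda>z. (f z - g z) * w z) p = \<infinity>"
    by (simp only: holo_order_eq_infinity_iff)
  moreover have "holo_order (\<lambda>z. (f z - g z) * w z) p = holo_order (\<lambda>z. f z - g z) p + holo_order w p"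
    by (intro holo_order_mult analytic_intros assms)
  ultimately have "holo_order (\<lambda>z. f z - g z) p = \<infinity>"
    using assms(4) by (simp add: plus_eq_infty_iff_enat)
  hence "\<forall>\<^sub>F z in nhds p. f z - g z = 0"
    by (simp only: holo_order_eq_infinity_iff)
  from eventually_nhds_x_imp_x[OF this] show ?thesis by simp
qed

lemma holo_order_finite_eventually_nonzero:
  assumes "f analytic_on {p}" "holo_order f p \<noteq> \<infinity>"
  shows "\<forall>\<^sub>F z in at p. f z \<noteq> 0"
  using assms(1)
proof (cases rule: holo_order_cases)
  case infinite
  thus ?thesis using assms(2) by simp
next
  case (finite n g)
  from finite(4) analytic_at_eventually_nonzero[OF finite(2,3)] show ?thesis
    unfolding eventually_at_filter by eventually_elim simp
qed

text \<open>Finite order at every point replaces connectedness of D: f vanishes identically near no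
  point, so its zeros are isolated.\<close>

lemma sparse_zeros:
  assumes "open D" "f holomorphic_on D" "\<And>p. p \<in> D \<Longrightarrow> holo_order f p \<noteq> \<infinity>"
  shows "{z \<in> D. f z = 0} sparse_in D"
  unfolding sparse_in_eventually_iff[OF assms(1)]
proof
  fix p assume p: "p \<in> D"
  hence "f analytic_on {p}" using assms(1,2) analytic_at by blast
  from holo_order_finite_eventually_nonzero[OF this assms(3)[OF p]]
  show "\<forall>\<^sub>F z in at p. z \<notin> {z \<in> D. f z = 0}"
    by eventually_elim simp
qed

text \<open>The two pairs are linear combinations of each other, so a power of z - p divides both
  members of one pair exactly when it divides both members of the other.\<close>

lemma min_holo_order_half_sum_diff:
  assumes "f analytic_on {p}" "g analytic_on {p}"
  shows "min (holo_order (\<lambda>z. (f z + g z) / 2) p) (holo_order (\<lambda>z. (f z - g z) / (2 * \<i>)) p)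
    = min (holo_order f p) (holo_order g p)" (is "min (holo_order ?a p) (holo_order ?b p) = _")
proof (rule enat_eqI)
  fix k
  have lin: "enat k \<le> holo_order (\<lambda>z. c * r z + d * s z) p"
    if "r analytic_on {p}" "s analytic_on {p}" "enat k \<le> holo_order r p" "enat k \<le> holo_order s p"
    for r s c d
    using that by (intro holo_order_add_ge holo_order_cmult_ge analytic_intros)
  have an: "?a analytic_on {p}" "?b analytic_on {p}"
    using assms by (auto intro!: analytic_intros)
  have ab: "?a = (\<lambda>z. (1/2) * f z + (1/2) * g z)" "?b = (\<lambda>z. (1/(2*\<i>)) * f z + (-1/(2*\<i>)) * g z)"
    by (auto simp: fun_eq_iff field_simps)
  have fg: "f = (\<lambda>z. 1 * ?a z + \<i> * ?b z)" "g = (\<lambda>z. 1 * ?a z + (-\<i>) * ?b z)"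
    by (auto simp: fun_eq_iff field_simps)
  show "enat k \<le> min (holo_order ?a p) (holo_order ?b p) \<longleftrightarrow> enat k \<le> min (holo_order f p) (holo_order g p)"
  proof
    assume "enat k \<le> min (holo_order ?a p) (holo_order ?b p)"
    hence *: "enat k \<le> holo_order ?a p" "enat k \<le> holo_order ?b p" by (auto simp: min_le_iff_disj)
    have "enat k \<le> holo_order f p" by (subst fg(1), rule lin[OF an *])
    moreover have "enat k \<le> holo_order g p" by (subst fg(2), rule lin[OF an *])
    ultimately show "enat k \<le> min (holo_order f p) (holo_order g p)" by simp
  next
    assume "enat k \<le> min (holo_order f p) (holo_order g p)"
    hence *: "enat k \<le> holo_order f p" "enat k \<le> holo_order g p" by auto
    have "enat k \<le> holo_order ?a p" unfolding ab by (rule lin[OF assms *])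
    moreover have "enat k \<le> holo_order ?b p" unfolding ab by (rule lin[OF assms *])
    ultimately show "enat k \<le> min (holo_order ?a p) (holo_order ?b p)" by simp
  qed
qed

section \<open>The Weierstrass theorem on open sets\<close>

lemma holo_order_prod:
  assumes "\<And>n. n \<in> A \<Longrightarrow> f n analytic_on {p}"
  shows "holo_order (\<lambda>z. \<Prod>n\<in>A. f n z) p = (\<Sum>n\<in>A. holo_order (f n) p)"
  using assms
proof (induction A rule: infinite_finite_induct)
  case (insert x F)
  have "holo_order (\<lambda>z. f x z * (\<Prod>n\<in>F. f n z)) p = holo_order (f x) p + holo_order (\<lambda>z. \<Prod>n\<in>F. f n z) p"
    using insert by (intro holo_order_mult analytic_intros) auto
  thus ?case using insert by simp
qed (auto intro!: holo_order_nonzero)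

section \<open>Infinite products with rapidly converging factors\<close>

text \<open>The bound is the estimate |E_n(w) - 1| <= 3 |w|^(n+1) for Weierstrass factors, taken at
  |w| <= 1/2. It is demanded only for large n, depending on K, because early factors may vanish on
  K.\<close>

locale rapid_product =
  fixes D :: "complex set" and q :: "nat \<Rightarrow> complex \<Rightarrow> complex"
  assumes open_D: "open D"
    and holomorphic_factor: "\<And>n. q n holomorphic_on D"
    and factor_bound: "\<And>K. compact K \<Longrightarrow> K \<subseteq> D \<Longrightarrow>
      \<forall>\<^sub>F n in sequentially. \<forall>z\<in>K. norm (q n z - 1) \<le> 3 * (1 / 2) ^ Suc n"
begin

lemma abs_convergent:
  assumes "z \<in> D"
  shows "abs_convergent_prod (\<lambda>n. q n z)"
  unfolding abs_convergent_prod_conv_summable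
proof (rule summable_comparison_test_ev)
  show "\<forall>\<^sub>F n in sequentially. norm (norm (q n z - 1)) \<le> 3 * (1 / 2) ^ Suc n"
    using factor_bound[of "{z}"] assms by simp
  show "summable (\<lambda>n. 3 * (1 / 2) ^ Suc n :: real)"
    by (intro summable_mult) (simp only: summable_Suc_iff, intro summable_geometric, simp)
qed

lemma convergent:
  assumes "z \<in> D"
  shows "convergent_prod (\<lambda>n. q n z)"
  using abs_convergent[OF assms] abs_convergent_prod_imp_convergent_prod by blast

lemma uniform_limit_prod:
  assumes "compact K" "K \<subseteq> D"
  shows "uniform_limit K (\<lambda>N z. \<Prod>n<N. q n z) (\<lambda>z. \<Prod>n. q n z) sequentially"
proof -
  have "uniformly_convergent_on K (\<lambda>N z. \<Prod>n<N. q n z)"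
  proof (rule uniformly_convergent_on_prod')
    show "uniformly_convergent_on K (\<lambda>N z. \<Sum>n<N. norm (q n z - 1))"
    proof (rule Weierstrass_m_test'_ev)
      show "\<forall>\<^sub>F n in sequentially. \<forall>z\<in>K. norm (norm (q n z - 1)) \<le> 3 * (1 / 2) ^ Suc n"
        using factor_bound[OF assms] by simp
      show "summable (\<lambda>n. 3 * (1 / 2) ^ Suc n :: real)"
        by (intro summable_mult) (simp only: summable_Suc_iff, intro summable_geometric, simp)
    qed
    show "continuous_on K (q n)" for n
      using holomorphic_factor assms(2) holomorphic_on_imp_continuous_on continuous_on_subset by blast
  qed fact
  then obtain g where g: "uniform_limit K (\<lambda>N z. \<Prod>n<N. q n z) g sequentially"
    by (auto simp: uniformly_convergent_on_def)
  moreover have "g z = (\<Prod>n. q n z)" if "z \<in> K" for z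
  proof -
    have "(\<lambda>N. \<Prod>n<Suc N. q n z) \<longlonglongrightarrow> g z"
      using tendsto_uniform_limitI[OF g that] by (rule LIMSEQ_Suc)
    moreover have "(\<lambda>N. \<Prod>n<Suc N. q n z) \<longlonglongrightarrow> (\<Prod>n. q n z)"
      using convergent_prod_LIMSEQ[OF convergent[of z]] that assms(2) unfolding lessThan_Suc_atMost by blast
    ultimately show ?thesis by (rule LIMSEQ_unique)
  qed
  ultimately show ?thesis
    using uniform_limit_cong'[of K "\<lambda>N z. \<Prod>n<N. q n z" "\<lambda>N z. \<Prod>n<N. q n z" g "\<lambda>z. \<Prod>n. q n z"] by simp
qed

lemma holomorphic: "(\<lambda>z. \<Prod>n. q n z) holomorphic_on D"
proof (rule holomorphic_uniform_sequence)
  show "open D" by (rule open_D)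
  show "(\<lambda>z. \<Prod>n<N. q n z) holomorphic_on D" for N
    by (intro holomorphic_intros holomorphic_factor)
  fix z assume "z \<in> D"
  then obtain d where "d > 0" "cball z d \<subseteq> D"
    using open_D open_contains_cball by blast
  thus "\<exists>d>0. cball z d \<subseteq> D \<and>
      uniform_limit (cball z d) (\<lambda>N z. \<Prod>n<N. q n z) (\<lambda>z. \<Prod>n. q n z) sequentially"
    using uniform_limit_prod[of "cball z d"] by auto
qed

text \<open>Makes holomorphy and convergence available for tails of the product, so that finitely
  many factors can be split off.\<close>

lemma rapid_product_shift: "rapid_product D (\<lambda>n. q (n + N))"
proof
  fix K assume K: "compact K" "K \<subseteq> D"
  from eventually_all_ge_at_top[OF factor_bound[OF K]]
  obtain M where M: "\<And>n z. n \<ge> M \<Longrightarrow> z \<in> K \<Longrightarrow> norm (q n z - 1) \<le> 3 * (1 / 2) ^ Suc n"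
    by (auto simp: eventually_at_top_linorder)
  have "norm (q (n + N) z - 1) \<le> 3 * (1 / 2) ^ Suc n" if "n \<ge> M" "z \<in> K" for n z
  proof -
    have "norm (q (n + N) z - 1) \<le> 3 * (1 / 2) ^ Suc (n + N)"
      using that by (intro M) auto
    also have "\<dots> \<le> 3 * (1 / 2) ^ Suc n"
      by (intro mult_left_mono power_decreasing) auto
    finally show ?thesis .
  qed
  thus "\<forall>\<^sub>F n in sequentially. \<forall>z\<in>K. norm (q (n + N) z - 1) \<le> 3 * (1 / 2) ^ Suc n"
    unfolding eventually_at_top_linorder by blast
qed (rule open_D holomorphic_factor)+

text \<open>From some index on the factors do not vanish at p, hence neither does the tail; the
  order comes from the finitely many factors before it.\<close>

lemma holo_order_eq:
  assumes p: "p \<in> D"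
  shows "\<exists>N. (\<forall>n\<ge>N. q n p \<noteq> 0) \<and>
    holo_order (\<lambda>z. \<Prod>n. q n z) p = (\<Sum>n<N. holo_order (q n) p)"
proof -
  have "\<forall>\<^sub>F n in sequentially. \<forall>z\<in>{p}. norm (q n z - 1) \<le> 3 * (1 / 2) ^ Suc n"
    by (rule factor_bound) (use p in auto)
  then obtain M where M: "\<And>n. n \<ge> M \<Longrightarrow> norm (q n p - 1) \<le> 3 * (1 / 2) ^ Suc n"
    by (auto simp: eventually_at_top_linorder)
  \<comment> \<open>At index 0 the bound is 3/2, which does not exclude a zero; from index 1 on it
    is at most 3/4.\<close>
  define N where "N = max M 1"
  have nz: "q n p \<noteq> 0" if "n \<ge> N" for n
  proof
    assume 0: "q n p = 0"
    have "norm (q n p - 1) \<le> 3 * (1 / 2) ^ Suc n"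
      using that by (intro M) (simp add: N_def)
    also have "\<dots> \<le> 3 * (1 / 2) ^ Suc 1"
      using that by (intro mult_left_mono power_decreasing) (auto simp: N_def)
    finally show False using 0 by simp
  qed
  interpret tail: rapid_product D "\<lambda>n. q (n + N)" by (rule rapid_product_shift)
  define h where "h = (\<lambda>z. \<Prod>n. q (n + N) z)"
  have an_q: "q n analytic_on {p}" for n
    using holomorphic_factor[of n] open_D p analytic_at by blast
  have an_h: "h analytic_on {p}"
    using tail.holomorphic open_D p analytic_at unfolding h_def by blast
  have "(\<lambda>n. q (n + N) p) has_prod h p"
    unfolding h_def by (intro convergent_prod_has_prod tail.convergent p)
  \<comment> \<open>A convergent product vanishes only if one of its factors does.\<close>
  hence hp: "h p \<noteq> 0"
    using has_prod_eq_0_iff nz by (metis (no_types, lifting) le_add2 rangeE)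
  have "(\<Prod>n. q n z) = (\<Prod>n<N. q n z) * h z" if "z \<in> D" for z
    unfolding h_def
    by (rule has_prod_unique2[OF convergent_prod_has_prod has_prod_ignore_initial_segment'])
      (use that convergent in blast)+
  moreover have "\<forall>\<^sub>F z in nhds p. z \<in> D"
    using open_D p by (rule eventually_nhds_in_open)
  ultimately have "holo_order (\<lambda>z. \<Prod>n. q n z) p = holo_order (\<lambda>z. (\<Prod>n<N. q n z) * h z) p"
    by (intro holo_order_cong) (auto elim: eventually_mono)
  also have "\<dots> = holo_order (\<lambda>z. \<Prod>n<N. q n z) p + holo_order h p"
    by (intro holo_order_mult analytic_intros an_q an_h)
  also have "\<dots> = (\<Sum>n<N. holo_order (q n) p)"
    by (simp add: holo_order_prod an_q holo_order_nonzero[OF an_h hp])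
  finally show ?thesis using nz by blast
qed

end

section \<open>Weierstrass factors anchored at the boundary or at infinity\<close>

text \<open>These sets exhaust D: a point of D outside one of them is far out or close to the
  boundary, the two situations in which a zero can be dealt with.\<close>

lemma compact_infdist_ge:
  fixes D :: "'a :: heine_borel set" and a :: 'a
  assumes "open D" "D \<noteq> UNIV" "e > 0"
  shows "compact {z \<in> cball a r. infdist z (- D) \<ge> e}" "{z \<in> cball a r. infdist z (- D) \<ge> e} \<subseteq> D"
proof -
  have "closed {z. infdist z (- D) \<ge> e}"
    by (intro closed_Collect_le continuous_intros)
  hence "compact (cball a r \<inter> {z. infdist z (- D) \<ge> e})"
    by (intro compact_Int_closed) auto
  also have "cball a r \<inter> {z. infdist z (- D) \<ge> e} = {z \<in> cball a r. infdist z (- D) \<ge> e}"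
    by blast
  finally show "compact {z \<in> cball a r. infdist z (- D) \<ge> e}" .
  show "{z \<in> cball a r. infdist z (- D) \<ge> e} \<subseteq> D"
  proof
    fix z assume "z \<in> {z \<in> cball a r. infdist z (- D) \<ge> e}"
    hence "infdist z (- D) \<noteq> 0" using assms(3) by auto
    thus "z \<in> D" by (metis ComplI infdist_zero)
  qed
qed

text \<open>The exponential part of a Weierstrass factor has no zeros, so the order is that of
  \<open>1 - \<psi>\<close>.\<close>

lemma holo_order_weierstrass_factor:
  assumes "\<psi> analytic_on {p}" "r analytic_on {p}" "r p \<noteq> 0"
    "\<forall>\<^sub>F z in nhds p. 1 - \<psi> z = (z - p) * r z"
  shows "holo_order (\<lambda>z. weierstrass_factor n (\<psi> z)) p = 1"
proof -
  define g where "g = (\<lambda>z. r z * exp (\<Sum>k=1..n. \<psi> z ^ k / of_nat k))"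
  have "holo_order (\<lambda>z. weierstrass_factor n (\<psi> z)) p = enat 1"
  proof (rule holo_order_eqI)
    show "g analytic_on {p}"
      unfolding g_def by (intro analytic_intros assms) auto
    show "g p \<noteq> 0" using assms(3) by (simp add: g_def)
    show "\<forall>\<^sub>F z in nhds p. weierstrass_factor n (\<psi> z) = (z - p) ^ 1 * g z"
      using assms(4) by eventually_elim (simp add: weierstrass_factor_def g_def)
  qed
  thus ?thesis by (simp add: one_enat_def)
qed

text \<open>
  A zero \<open>a\<close> close to the boundary of \<open>D\<close> gets a factor with essential singularity at a nearest
  boundary point, any other zero one with essential singularity at infinity. The dividing line
  \<open>infdist a (- D) * norm a = 1\<close> makes both families converge; the first family
  also contains \<open>a = 0\<close>, except when \<open>D\<close> is the whole plane, which is excluded there because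
  \<open>infdist a {} = 0\<close>.
\<close>

definition weierstrass_arg :: "complex set \<Rightarrow> complex \<Rightarrow> complex \<Rightarrow> complex" where
  "weierstrass_arg D a z =
     (if D \<noteq> UNIV \<and> infdist a (- D) * norm a \<le> 1
      then let b = (SOME b. b \<in> - D \<and> infdist a (- D) = dist a b) in (a - b) / (z - b)
      else if a = 0 then 1 - z else z / a)"

lemma nearest_point_SOME:
  fixes D :: "complex set" and a :: complex
  assumes "open D" "D \<noteq> UNIV"
  defines "b \<equiv> (SOME b. b \<in> - D \<and> infdist a (- D) = dist a b)"
  shows "b \<notin> D" "infdist a (- D) = dist a b"
proof -
  have "\<exists>b. b \<in> - D \<and> infdist a (- D) = dist a b"
    using infdist_attains_inf[of "- D" a] assms(1,2) by blast
  from someI_ex[OF this] show "b \<notin> D" "infdist a (- D) = dist a b"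
    unfolding b_def by auto
qed

lemma weierstrass_arg_cases:
  fixes D :: "complex set" and a :: complex
  assumes "open D"
  obtains (boundary) b where "D \<noteq> UNIV" "infdist a (- D) * norm a \<le> 1" "b \<notin> D" "infdist a (- D) = dist a b"
      "weierstrass_arg D a = (\<lambda>z. (a - b) / (z - b))"
  | (zero) "a = 0" "D = UNIV" "weierstrass_arg D a = (\<lambda>z. 1 - z)"
  | (infinity) "a \<noteq> 0" "D = UNIV \<or> infdist a (- D) * norm a > 1" "weierstrass_arg D a = (\<lambda>z. z / a)"
proof -
  consider "D \<noteq> UNIV" "infdist a (- D) * norm a \<le> 1" | "D = UNIV" "a = 0"
    | "D = UNIV \<or> infdist a (- D) * norm a > 1" "a \<noteq> 0"
    by (cases "a = 0"; cases "D = UNIV"; cases "infdist a (- D) * norm a \<le> 1") auto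
  thus ?thesis
  proof cases
    case 1
    have "weierstrass_arg D a = (\<lambda>z. (a - (SOME b. b \<in> - D \<and> infdist a (- D) = dist a b)) /
        (z - (SOME b. b \<in> - D \<and> infdist a (- D) = dist a b)))"
      using 1 by (simp add: weierstrass_arg_def Let_def fun_eq_iff)
    with 1 nearest_point_SOME[OF assms 1(1), of a] show ?thesis
      by (intro boundary)
  next
    case 2
    thus ?thesis by (intro zero) (auto simp: weierstrass_arg_def)
  next
    case 3
    thus ?thesis by (intro infinity) (auto simp: weierstrass_arg_def)
  qed
qed

lemma weierstrass_arg_holomorphic:
  assumes "open D"
  shows "weierstrass_arg D a holomorphic_on D"
  using assms
  by (cases rule: weierstrass_arg_cases[where a = a]) (auto intro!: holomorphic_intros)

lemma weierstrass_arg_eq_1_iff: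
  assumes "open D" "z \<in> D"
  shows "weierstrass_arg D a z = 1 \<longleftrightarrow> z = a"
  using assms(1) by (cases rule: weierstrass_arg_cases[where a = a]) (use assms(2) in auto)

text \<open>One minus the argument equals z - a times 1 / (z - b), 1 or -1 / a in the three cases,
  which is a simple zero at a; elsewhere in D the argument differs from 1.\<close>

lemma holo_order_weierstrass_arg:
  assumes "open D" "a \<in> D" "p \<in> D"
  shows "holo_order (\<lambda>z. weierstrass_factor n (weierstrass_arg D a z)) p = (if p = a then 1 else 0)"
proof (cases "p = a")
  case False
  have "(\<lambda>z. weierstrass_factor n (weierstrass_arg D a z)) analytic_on {p}"
    using weierstrass_arg_holomorphic[OF assms(1), of a] assms
    by (intro analytic_intros) (auto simp: analytic_at)
  thus ?thesis using False weierstrass_arg_eq_1_iff[OF assms(1,3), of a]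
    by (simp add: holo_order_nonzero)
next
  case True
  have an: "weierstrass_arg D a analytic_on {a}"
    using weierstrass_arg_holomorphic[OF assms(1), of a] assms by (auto simp: analytic_at)
  have nhds: "\<forall>\<^sub>F z in nhds a. z \<in> D"
    using assms by (intro eventually_nhds_in_open)
  show ?thesis using assms(1)
  proof (cases rule: weierstrass_arg_cases[where a = a])
    case (boundary b)
    have "holo_order (\<lambda>z. weierstrass_factor n (weierstrass_arg D a z)) a = 1"
    proof (rule holo_order_weierstrass_factor[OF an])
      show "(\<lambda>z. 1 / (z - b)) analytic_on {a}" "1 / (a - b) \<noteq> 0"
        using boundary(3) assms(2) by (auto intro!: analytic_intros)
      show "\<forall>\<^sub>F z in nhds a. 1 - weierstrass_arg D a z = (z - a) * (1 / (z - b))"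
        using nhds
      proof eventually_elim
        case (elim z)
        hence "z \<noteq> b" using boundary(3) by auto
        thus ?case by (simp add: boundary(5) field_simps)
      qed
    qed
    thus ?thesis using True by simp
  next
    case zero
    have "holo_order (\<lambda>z. weierstrass_factor n (weierstrass_arg D a z)) a = 1"
    proof (rule holo_order_weierstrass_factor[OF an, of "\<lambda>_. 1"])
      show "\<forall>\<^sub>F z in nhds a. 1 - weierstrass_arg D a z = (z - a) * 1"
        unfolding zero(3) using zero(1) by simp
    qed simp_all
    thus ?thesis using True by simp
  next
    case infinity
    have "holo_order (\<lambda>z. weierstrass_factor n (weierstrass_arg D a z)) a = 1"
      by (rule holo_order_weierstrass_factor[OF an, of "\<lambda>_. - 1 / a"])
         (auto simp: infinity field_simps)
    thus ?thesis using True by simp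
  qed
qed

lemma norm_weierstrass_arg_le:
  assumes "open D" "compact K" "K \<subseteq> D"
  obtains K' where "compact K'" "K' \<subseteq> D"
    "\<And>a z. a \<in> D - K' \<Longrightarrow> z \<in> K \<Longrightarrow> norm (weierstrass_arg D a z) \<le> 1 / 2"
proof -
  obtain R where R: "R > 0" "\<And>z. z \<in> K \<Longrightarrow> norm z \<le> R"
    using compact_imp_bounded[OF assms(2)] bounded_pos by blast
  show ?thesis
  proof (cases "D = UNIV")
    case True
    show ?thesis
    proof (rule that[of "cball 0 (2 * R)"])
      fix a z assume az: "a \<in> D - cball 0 (2 * R)" "z \<in> K"
      hence "norm a > 2 * R" "norm z \<le> R" using R by auto
      moreover have "a \<noteq> 0" using \<open>norm a > 2 * R\<close> R(1) by auto
      ultimately show "norm (weierstrass_arg D a z) \<le> 1 / 2"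
        using True R(1) by (auto simp: weierstrass_arg_def norm_divide field_simps)
    qed (use True in auto)
  next
    case False
    obtain \<delta> where \<delta>: "\<delta> > 0" "\<And>z b. z \<in> K \<Longrightarrow> b \<notin> D \<Longrightarrow> \<delta> \<le> dist z b"
      using separate_compact_closed[of K "- D"] assms by force
    \<comment> \<open>The bound \<open>\<delta> / 2\<close> serves boundary zeros: if
      \<open>dist a b\<close> exceeded it, then |a| <= \<open>2 / \<delta>\<close> and a would lie
      in K'. The bound 1 / (2 * R) serves the zeros handled at infinity: |a| < 2 * R would force
      \<open>infdist\<close> above it, again putting a into K'. The radius of K' is the larger of
      the two bounds on |a|.\<close>
    define e where "e = min (\<delta> / 2) (1 / (2 * R))"
    define K' where "K' = {z \<in> cball 0 (max (2 / \<delta>) (2 * R)). infdist z (- D) \<ge> e}"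
    have "e > 0" using \<delta>(1) R(1) by (simp add: e_def)
    show ?thesis
    proof (rule that[of K'])
      show "compact K'" "K' \<subseteq> D"
        unfolding K'_def using compact_infdist_ge[OF assms(1) False \<open>e > 0\<close>] by blast+
      fix a z assume az: "a \<in> D - K'" "z \<in> K"
      show "norm (weierstrass_arg D a z) \<le> 1 / 2" using assms(1)
      proof (cases rule: weierstrass_arg_cases[where a = a])
        case (boundary b)
        have "dist a b \<le> \<delta> / 2"
        proof (rule ccontr)
          assume *: "\<not> dist a b \<le> \<delta> / 2"
          have "norm a * (\<delta> / 2) \<le> norm a * dist a b"
            using * by (intro mult_left_mono) auto
          also have "\<dots> \<le> 1" using boundary by (simp add: mult.commute)
          finally have "norm a \<le> 2 / \<delta>" using \<delta>(1) by (simp add: field_simps)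
          hence "a \<in> K'" using * boundary(4) by (simp add: K'_def e_def le_max_iff_disj min_le_iff_disj)
          thus False using az by simp
        qed
        moreover have "\<delta> \<le> dist z b" using \<delta>(2) az boundary by blast
        ultimately have "2 * dist a b \<le> dist z b" by simp
        moreover have "dist z b > 0" using \<open>\<delta> \<le> dist z b\<close> \<delta>(1) by linarith
        ultimately show ?thesis
          unfolding boundary(5) norm_divide dist_norm by (simp add: field_simps)
      next
        case zero
        thus ?thesis using False by simp
      next
        case infinity
        have "norm a \<ge> 2 * R"
        proof (rule ccontr)
          assume *: "\<not> norm a \<ge> 2 * R"
          have "1 < infdist a (- D) * norm a" using infinity(2) False by simp
          also have "\<dots> \<le> infdist a (- D) * (2 * R)"
            using * by (intro mult_left_mono infdist_nonneg) auto
          finally have "infdist a (- D) \<ge> 1 / (2 * R)" using R(1) by (simp add: field_simps)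
          hence "a \<in> K'" using * by (simp add: K'_def e_def le_max_iff_disj min_le_iff_disj)
          thus False using az by simp
        qed
        moreover have "norm z \<le> R" using R(2) az by blast
        ultimately have "2 * norm z \<le> norm a" by simp
        thus ?thesis
          using infinity(1) unfolding infinity(3) norm_divide by (simp add: field_simps)
      qed
    qed
  qed
qed

text \<open>The factor with index n has genus n. Thus arguments of modulus at most 1/2 already give
  convergence, and no growth condition on the zeros is needed.\<close>

theorem weierstrass_divisor:
  fixes m :: "complex \<Rightarrow> nat"
  assumes "open D" and sparse: "{z \<in> D. m z > 0} sparse_in D"
  obtains W where "W holomorphic_on D" "\<And>p. p \<in> D \<Longrightarrow> holo_order W p = enat (m p)"
proof -
  define S where "S = {z \<in> D. m z > 0}"
  \<comment> \<open>Each zero is listed m z times, as pairs with a counter, so every factor only has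
    to contribute a simple zero.\<close>
  define Z where "Z = Sigma S (\<lambda>z. {..<m z})"
  have "countable S"
    using sparse_imp_countable[OF assms] by (rule countable_subset[rotated]) (auto simp: S_def)
  hence "countable Z" by (auto simp: Z_def)
  then obtain e :: "complex \<times> nat \<Rightarrow> nat" where e: "inj_on e Z"
    by (auto simp: countable_def)
  define a where "a = (\<lambda>n. fst (inv_into Z e n))"
  define q where "q = (\<lambda>n z. if n \<in> e ` Z then weierstrass_factor n (weierstrass_arg D (a n) z) else 1)"
  have a_e: "a (e x) = fst x" if "x \<in> Z" for x
    using that e by (simp add: a_def)
  have a_D: "a n \<in> D" if "n \<in> e ` Z" for n
  proof -
    from that obtain x where x: "x \<in> Z" "n = e x" by blast
    thus ?thesis using a_e[OF x(1)] by (auto simp: Z_def S_def)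
  qed
  have hol: "q n holomorphic_on D" for n
  proof (cases "n \<in> e ` Z")
    case True
    thus ?thesis
      using weierstrass_arg_holomorphic[OF assms(1)] by (simp add: q_def weierstrass_factor_holomorphic)
  qed (simp add: q_def)
  interpret rapid_product D q
  proof
    fix K assume K: "compact K" "K \<subseteq> D"
    from norm_weierstrass_arg_le[OF assms(1) K]
    obtain K' where K': "compact K'" "K' \<subseteq> D"
      "\<And>a z. a \<in> D - K' \<Longrightarrow> z \<in> K \<Longrightarrow> norm (weierstrass_arg D a z) \<le> 1 / 2" by blast
    \<comment> \<open>Only the indices of the finitely many zeros in K' can violate the bound on
      K.\<close>
    have "finite (K' \<inter> S)"
      using sparse_in_compact_finite[OF sparse_in_subset[OF sparse K'(2)] K'(1)] by (simp add: S_def)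
    hence "finite (Sigma (K' \<inter> S) (\<lambda>z. {..<m z}))" by auto
    hence "finite (e ` Sigma (K' \<inter> S) (\<lambda>z. {..<m z}))"
      by (rule finite_imageI)
    hence "\<forall>\<^sub>F n in sequentially. n \<notin> e ` Sigma (K' \<inter> S) (\<lambda>z. {..<m z})"
      unfolding cofinite_eq_sequentially[symmetric] eventually_cofinite not_not by simp
    thus "\<forall>\<^sub>F n in sequentially. \<forall>z\<in>K. norm (q n z - 1) \<le> 3 * (1 / 2) ^ Suc n"
    proof eventually_elim
      case (elim n)
      show ?case
      proof
        fix z assume "z \<in> K"
        show "norm (q n z - 1) \<le> 3 * (1 / 2) ^ Suc n"
        proof (cases "n \<in> e ` Z")
          case True
          then obtain x where x: "x \<in> Z" "n = e x" by blast
          have "a n \<notin> K'"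
          proof
            assume "a n \<in> K'"
            hence "x \<in> Sigma (K' \<inter> S) (\<lambda>z. {..<m z})"
              using x a_e[OF x(1)] by (auto simp: Z_def)
            with elim x(2) show False by simp
          qed
          with K'(3) a_D[OF True] \<open>z \<in> K\<close> have *: "norm (weierstrass_arg D (a n) z) \<le> 1 / 2" by blast
          have "norm (q n z - 1) \<le> 3 * norm (weierstrass_arg D (a n) z) ^ Suc n"
            using weierstrass_factor_bound[OF *, of n] True by (simp add: q_def)
          also have "\<dots> \<le> 3 * (1 / 2) ^ Suc n"
            using * by (intro mult_left_mono power_mono) auto
          finally show ?thesis .
        qed (simp add: q_def)
      qed
    qed
  qed (rule assms(1) hol)+
  have "holo_order (\<lambda>z. \<Prod>n. q n z) p = enat (m p)" if p: "p \<in> D" for p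
  proof -
    obtain N where N: "\<And>n. n \<ge> N \<Longrightarrow> q n p \<noteq> 0"
      "holo_order (\<lambda>z. \<Prod>n. q n z) p = (\<Sum>n<N. holo_order (q n) p)"
      using holo_order_eq[OF p] by blast
    have ord: "holo_order (q n) p = (if n \<in> e ` Z \<and> a n = p then 1 else 0)" for n
    proof (cases "n \<in> e ` Z")
      case True
      thus ?thesis using holo_order_weierstrass_arg[OF assms(1) a_D[OF True] p, of n]
        by (auto simp: q_def [abs_def])
    next
      case False
      thus ?thesis by (simp add: q_def [abs_def] holo_order_nonzero)
    qed
    define T where "T = e ` ({p} \<times> {..<m p})"
    have T: "T = {n. n \<in> e ` Z \<and> a n = p}"
    proof -
      have "{p} \<times> {..<m p} = {x \<in> Z. fst x = p}"
        using p by (auto simp: Z_def S_def)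
      hence "T = e ` {x \<in> Z. fst x = p}" by (simp add: T_def)
      also have "\<dots> = {n. n \<in> e ` Z \<and> a n = p}"
      proof (intro equalityI subsetI)
        fix n assume "n \<in> e ` {x \<in> Z. fst x = p}"
        then obtain x where "x \<in> Z" "fst x = p" "n = e x" by blast
        thus "n \<in> {n. n \<in> e ` Z \<and> a n = p}" using a_e[of x] by simp
      next
        fix n assume "n \<in> {n. n \<in> e ` Z \<and> a n = p}"
        then obtain x where "x \<in> Z" "n = e x" "a n = p" by blast
        thus "n \<in> e ` {x \<in> Z. fst x = p}" using a_e[of x] by simp
      qed
      finally show ?thesis .
    qed
    have "card T = m p"
    proof -
      have "inj_on e ({p} \<times> {..<m p})"
        by (rule inj_on_subset[OF e]) (use p in \<open>auto simp: Z_def S_def\<close>)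
      thus ?thesis by (simp add: T_def card_image)
    qed
    \<comment> \<open>Ensures that the cut at N loses no factor vanishing at p, so that the sum
      counts all m p of them.\<close>
    have "T \<subseteq> {..<N}"
    proof
      fix n assume "n \<in> T"
      hence "q n p = 0"
        using weierstrass_arg_eq_1_iff[OF assms(1) p] by (simp add: T q_def)
      thus "n \<in> {..<N}" using N(1) by (meson lessThan_iff not_le)
    qed
    have "(\<Sum>n<N. holo_order (q n) p) = (\<Sum>n\<in>T. 1)"
      unfolding ord using \<open>T \<subseteq> {..<N}\<close> by (intro sum.mono_neutral_cong_right) (auto simp: T)
    also have "\<dots> = enat (m p)"
      by (simp add: \<open>card T = m p\<close> of_nat_eq_enat)
    finally show ?thesis using N(2) by simp
  qed
  with holomorphic show ?thesis by (rule that)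
qed

section \<open>Sums of squares on a domain symmetric about the real axis\<close>

locale reflected_domain =
  fixes D :: "complex set"
  assumes open_D: "open D" and cnj_D: "cnj ` D = D"
    and simply_connected_upper: "simply_connected (D \<inter> {z. 0 < Im z})"
begin

text \<open>The stem condition for complex-valued holomorphic functions; such a function is real at
  the real points of D.\<close>

definition reflective :: "(complex \<Rightarrow> complex) \<Rightarrow> bool" where
  "reflective f \<longleftrightarrow> f holomorphic_on D \<and> (\<forall>z\<in>D. f (cnj z) = cnj (f z))"

lemma cnj_mem [simp]: "cnj z \<in> D \<longleftrightarrow> z \<in> D"
  using cnj_D by (metis complex_cnj_cnj imageI)

lemma nhds_D: "p \<in> D \<Longrightarrow> \<forall>\<^sub>F z in nhds p. z \<in> D"
  using open_D by (rule eventually_nhds_in_open)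

lemma analytic_at_D: "f holomorphic_on D \<Longrightarrow> p \<in> D \<Longrightarrow> f analytic_on {p}"
  using open_D analytic_at by blast

lemma reflective_analytic: "reflective f \<Longrightarrow> p \<in> D \<Longrightarrow> f analytic_on {p}"
  by (simp add: reflective_def analytic_at_D)

lemma open_upper: "open (D \<inter> {z. 0 < Im z})"
  by (intro open_Int open_D open_halfspace_Im_gt)

text \<open>Carries a local property from a real point into the upper half, where connectedness is
  available.\<close>

lemma upper_near_real:
  assumes "x \<in> D" "Im x = 0" "\<forall>\<^sub>F z in nhds x. P z"
  obtains z where "z \<in> D" "0 < Im z" "P z"
proof -
  have "\<forall>\<^sub>F z in nhds x. z \<in> D \<and> P z"
    using nhds_D[OF assms(1)] assms(3) by eventually_elim simp
  then obtain e where e: "e > 0" "\<And>z. dist z x < e \<Longrightarrow> z \<in> D \<and> P z"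
    unfolding eventually_nhds_metric by blast
  have "dist (x + \<i> * of_real (e / 2)) x < e"
    using e(1) by (simp add: dist_norm norm_mult)
  from e(2)[OF this] show ?thesis
    using that e(1) assms(2) by auto
qed

lemma reflective_holo_order_cnj:
  assumes "reflective f" "p \<in> D"
  shows "holo_order f (cnj p) = holo_order f p"
proof -
  have "holo_order (cnj_conj f) p = holo_order f (cnj p)"
    by (rule holo_order_cnj_conj) (simp add: reflective_analytic assms)
  moreover have "\<forall>\<^sub>F z in nhds p. cnj_conj f z = f z"
    using nhds_D[OF assms(2)] by eventually_elim (use assms(1) in \<open>simp add: cnj_conj_def reflective_def\<close>)
  ultimately show ?thesis using holo_order_cong by metis
qed

text \<open>D itself may be disconnected, so the identity theorem is applied on the upper half only;
  symmetry then covers the lower half and continuity the real points.\<close>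

lemma reflective_identity:
  assumes f: "reflective f" and p: "p \<in> D" "holo_order f p = \<infinity>" and z: "z \<in> D"
  shows "f z = 0"
proof -
  obtain q where q: "q \<in> D" "0 < Im q" "\<forall>\<^sub>F z in nhds q. f z = 0"
  proof -
    consider "Im p > 0" | "Im p < 0" | "Im p = 0" by linarith
    thus ?thesis
    proof cases
      case 1
      thus ?thesis using that p by (simp only: holo_order_eq_infinity_iff)
    next
      case 2
      have "holo_order f (cnj p) = \<infinity>"
        using reflective_holo_order_cnj[OF f p(1)] p(2) by simp
      thus ?thesis using that[of "cnj p"] p 2 by (simp add: holo_order_eq_infinity_iff)
    next
      case 3
      have "\<forall>\<^sub>F z in nhds p. f z = 0" using p(2) by (simp only: holo_order_eq_infinity_iff)
      \<comment> \<open>Vanishing near p is itself an open condition, so it also holds around some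
        point of the upper half.\<close>
      hence "\<forall>\<^sub>F y in nhds p. \<forall>\<^sub>F z in nhds y. f z = 0" by (simp only: eventually_eventually)
      from upper_near_real[OF p(1) 3 this] that show ?thesis by blast
    qed
  qed
  have upper: "f w = 0" if "w \<in> D" "0 < Im w" for w
  proof -
    obtain S where S: "open S" "q \<in> S" "\<And>z. z \<in> S \<Longrightarrow> f z = 0"
      using q(3) unfolding eventually_nhds by blast
    show ?thesis
    proof (rule analytic_continuation_open[of "S \<inter> (D \<inter> {z. 0 < Im z})" "D \<inter> {z. 0 < Im z}" f "\<lambda>_. 0"])
      show "open (S \<inter> (D \<inter> {z. 0 < Im z}))" using S(1) open_upper by (rule open_Int)
      show "open (D \<inter> {z. 0 < Im z})" by (rule open_upper)
      show "connected (D \<inter> {z. 0 < Im z})"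
        by (rule simply_connected_imp_connected[OF simply_connected_upper])
      show "f holomorphic_on D \<inter> {z. 0 < Im z}"
        using f by (auto simp: reflective_def intro: holomorphic_on_subset)
    qed (use S q that in auto)
  qed
  consider "Im z > 0" | "Im z < 0" | "Im z = 0" by linarith
  thus ?thesis
  proof cases
    case 1
    thus ?thesis using upper z by blast
  next
    case 2
    have "f (cnj z) = 0" using 2 z by (intro upper) auto
    thus ?thesis using f z by (simp add: reflective_def)
  next
    case 3
    show ?thesis
    proof (rule ccontr)
      assume "f z \<noteq> 0"
      with analytic_at_eventually_nonzero[OF reflective_analytic[OF f z]]
      have "\<forall>\<^sub>F y in nhds z. f y \<noteq> 0" by blast
      from upper_near_real[OF z 3 this] upper show False by blast
    qed
  qed
qed

lemma at_within_Reals_nontrivial: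
  assumes "Im x = 0"
  shows "at x within \<real> \<noteq> bot"
proof -
  have "x islimpt \<real>"
    unfolding islimpt_approachable
  proof (intro allI impI)
    fix e :: real assume "e > 0"
    thus "\<exists>x'\<in>\<real>. x' \<noteq> x \<and> dist x' x < e"
      using assms by (intro bexI[of _ "x + of_real (e / 2)"])
        (auto simp: dist_norm complex_is_Real_iff)
  qed
  thus ?thesis by (simp add: trivial_limit_within)
qed

text \<open>For a germ whose values are controlled only at real points other than x, such as a
  quotient by a function vanishing at x. It is applied to reality and to nonnegativity of the real
  part.\<close>

lemma limit_along_Reals:
  assumes "g analytic_on {x}" "Im x = 0" "closed C" "\<forall>\<^sub>F z in at x. z \<in> \<real> \<longrightarrow> g z \<in> C"
  shows "g x \<in> C"
proof (rule Lim_in_closed_set[OF assms(3)])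
  show "\<forall>\<^sub>F z in at x within \<real>. g z \<in> C"
    using assms(4) unfolding eventually_at_filter by eventually_elim simp
  show "(g \<longlongrightarrow> g x) (at x within \<real>)"
    using assms(1) by (meson Lim_at_imp_Lim_at_within analytic_at_imp_isCont isContD)
qed (rule at_within_Reals_nontrivial[OF assms(2)])

text \<open>At a real point the leading coefficients are real, so their squares cannot cancel.\<close>

lemma holo_order_sum_squares_real:
  assumes "finite B" "\<And>b. b \<in> B \<Longrightarrow> reflective (F b)" "x \<in> D" "Im x = 0"
    and "\<And>b. b \<in> B \<Longrightarrow> enat n \<le> holo_order (F b) x" "b0 \<in> B" "holo_order (F b0) x = enat n"
  shows "holo_order (\<lambda>z. \<Sum>b\<in>B. (F b z)\<^sup>2) x = enat (2 * n)"
proof -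
  have "\<exists>g. g analytic_on {x} \<and> (\<forall>\<^sub>F z in nhds x. F b z = (z - x) ^ n * g z)" if "b \<in> B" for b
    using assms(5)[OF that] le_holo_order_iff[OF reflective_analytic[OF assms(2)[OF that] assms(3)]] by blast
  then obtain g where g: "\<And>b. b \<in> B \<Longrightarrow> g b analytic_on {x}"
      "\<And>b. b \<in> B \<Longrightarrow> \<forall>\<^sub>F z in nhds x. F b z = (z - x) ^ n * g b z"
    by metis
  \<comment> \<open>Off x the germ \<open>g b\<close> is \<open>F b z / (z - x) ^ n\<close>, a
    quotient of real numbers on the real axis; at x itself reality is a limit.\<close>
  have real: "g b x \<in> \<real>" if b: "b \<in> B" for b
  proof (rule limit_along_Reals[OF g(1)[OF b] assms(4) closed_complex_Reals])
    show "\<forall>\<^sub>F z in at x. z \<in> \<real> \<longrightarrow> g b z \<in> \<real>"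
      unfolding eventually_at_filter using g(2)[OF b] nhds_D[OF assms(3)]
    proof eventually_elim
      case (elim z)
      show ?case
      proof (intro impI)
        assume z: "z \<noteq> x" "z \<in> \<real>"
        have "x \<in> \<real>" using assms(4) by (simp add: complex_is_Real_iff)
        moreover have "cnj (F b z) = F b z"
          using assms(2)[OF b] elim(2) z(2) by (metis Reals_cnj_iff reflective_def)
        hence "F b z \<in> \<real>" by (simp add: Reals_cnj_iff)
        ultimately have "F b z / (z - x) ^ n \<in> \<real>" using z by (intro Reals_divide Reals_power Reals_diff)
        thus "g b z \<in> \<real>" using elim(1) z(1) by simp
      qed
    qed
  qed
  have "holo_order (F b0) x = holo_order (\<lambda>z. (z - x) ^ n * g b0 z) x"
    using g(2)[OF assms(6)] by (rule holo_order_cong)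
  also have "\<dots> = holo_order (\<lambda>z. (z - x) ^ n) x + holo_order (g b0) x"
    by (intro holo_order_mult analytic_intros g(1) assms(6))
  also have "holo_order (\<lambda>z. (z - x) ^ n) x = enat n"
    by (rule holo_order_eqI[of "\<lambda>_. 1"]) auto
  finally have "holo_order (g b0) x = 0"
    using assms(7) by (cases "holo_order (g b0) x") (auto simp: zero_enat_def)
  hence nz: "g b0 x \<noteq> 0"
    using holo_order_eq_0_iff[OF g(1)[OF assms(6)]] by simp
  show ?thesis
  proof (rule holo_order_eqI)
    show "(\<lambda>z. \<Sum>b\<in>B. (g b z)\<^sup>2) analytic_on {x}"
      by (intro analytic_intros g(1))
    have "(\<Sum>b\<in>B. (Re (g b x))\<^sup>2) > 0"
    proof (rule sum_pos2[OF assms(1) assms(6)])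
      have "Re (g b0 x) \<noteq> 0" using nz real[OF assms(6)] by (auto simp: complex_is_Real_iff complex_eq_iff)
      thus "(Re (g b0 x))\<^sup>2 > 0" by simp
    qed simp
    moreover have "(\<Sum>b\<in>B. (g b x)\<^sup>2) = of_real (\<Sum>b\<in>B. (Re (g b x))\<^sup>2)"
    proof -
      have "g b x = of_real (Re (g b x))" if "b \<in> B" for b
        using real[OF that] by (simp add: complex_is_Real_iff complex_eq_iff)
      thus ?thesis unfolding of_real_sum of_real_power by (intro sum.cong) auto
    qed
    ultimately show "(\<Sum>b\<in>B. (g b x)\<^sup>2) \<noteq> 0" by (metis less_irrefl of_real_eq_0_iff)
    have "\<forall>\<^sub>F z in nhds x. \<forall>b\<in>B. F b z = (z - x) ^ n * g b z"
      using g(2) by (intro eventually_ball_finite assms(1)) blast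
    thus "\<forall>\<^sub>F z in nhds x. (\<Sum>b\<in>B. (F b z)\<^sup>2) = (z - x) ^ (2 * n) * (\<Sum>b\<in>B. (g b z)\<^sup>2)"
    proof eventually_elim
      case (elim z)
      have "(\<Sum>b\<in>B. (F b z)\<^sup>2) = (\<Sum>b\<in>B. (z - x) ^ (2 * n) * (g b z)\<^sup>2)"
      proof (rule sum.cong[OF refl])
        fix b assume "b \<in> B"
        hence "F b z = (z - x) ^ n * g b z" using elim by blast
        thus "(F b z)\<^sup>2 = (z - x) ^ (2 * n) * (g b z)\<^sup>2"
          by (simp only: power_mult_distrib power_mult[symmetric] mult.commute[of n 2])
      qed
      thus ?case by (simp only: sum_distrib_left)
    qed
  qed
qed

section \<open>Symmetric square roots and factorization with a prescribed divisor\<close>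

text \<open>A root on the upper half is plus or minus the principal root near each real point,
  because u is positive there. It thus extends continuously and with real values to the real axis,
  where Schwarz reflection applies.\<close>

lemma reflective_sqrt:
  assumes u: "reflective u" and nz: "\<And>z. z \<in> D \<Longrightarrow> u z \<noteq> 0"
    and pos: "\<And>x. x \<in> D \<Longrightarrow> Im x = 0 \<Longrightarrow> 0 < Re (u x)"
  obtains s where "reflective s" "\<And>z. z \<in> D \<Longrightarrow> (s z)\<^sup>2 = u z"
proof -
  let ?U = "D \<inter> {z. 0 < Im z}"
  have hol_u: "u holomorphic_on D" using u by (simp add: reflective_def)
  have "\<exists>g. g holomorphic_on ?U \<and> (\<forall>z\<in>?U. u z = (g z)\<^sup>2)"
    using simply_connected_upper nz hol_u unfolding simply_connected_eq_holomorphic_sqrt[OF open_upper]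
    by (auto intro: holomorphic_on_subset)
  then obtain s0 where s0: "s0 holomorphic_on ?U" "\<And>z. z \<in> ?U \<Longrightarrow> u z = (s0 z)\<^sup>2"
    by blast
  \<comment> \<open>On the disc \<open>csqrt (u z)\<close> stays off its branch cut, and
    \<open>\<epsilon>\<close> is the sign relating it to \<open>s0\<close> on the upper half
    disc.\<close>
  define Q where "Q = (\<lambda>x e \<epsilon>. e > 0 \<and> ball x e \<subseteq> D \<and> (\<forall>z\<in>ball x e. Re (u z) > 0) \<and> \<epsilon>\<^sup>2 = 1 \<and>
      (\<forall>z\<in>ball x e \<inter> {z. 0 < Im z}. s0 z = \<epsilon> * csqrt (u z)))"
  have "\<exists>e \<epsilon>. Q x e \<epsilon>"
    if x: "x \<in> D" "Im x = 0" for x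
  proof -
    have "isCont u x"
      using reflective_analytic[OF u x(1)] by (rule analytic_at_imp_isCont)
    hence "((\<lambda>z. Re (u z)) \<longlongrightarrow> Re (u x)) (nhds x)"
      by (intro tendsto_Re) (simp add: isCont_def tendsto_at_iff_tendsto_nhds)
    hence "\<forall>\<^sub>F z in nhds x. Re (u z) > 0"
      using pos[OF x] by (rule order_tendstoD(1))
    hence "\<forall>\<^sub>F z in nhds x. z \<in> D \<and> Re (u z) > 0"
      using nhds_D[OF x(1)] by eventually_elim simp
    then obtain e where e: "e > 0" "\<And>z. dist z x < e \<Longrightarrow> z \<in> D \<and> Re (u z) > 0"
      unfolding eventually_nhds_metric by blast
    let ?B = "ball x e \<inter> {z. 0 < Im z}"
    have B: "z \<in> D" "Re (u z) > 0" "u z \<noteq> 0" "u z \<notin> \<real>\<^sub>\<le>\<^sub>0" if "z \<in> ball x e" for z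
      using e(2)[of z] that nz[of z] by (auto simp: dist_commute complex_nonpos_Reals_iff)
    define h where "h = (\<lambda>z. s0 z / csqrt (u z))"
    have cont: "continuous_on ?B h"
      unfolding h_def
    proof (intro continuous_intros)
      show "continuous_on ?B s0"
        using s0(1) B(1) by (intro holomorphic_on_imp_continuous_on) (auto intro: holomorphic_on_subset)
      show "continuous_on ?B (\<lambda>z. csqrt (u z))"
        using hol_u B by (intro holomorphic_on_imp_continuous_on holomorphic_intros) (auto intro: holomorphic_on_subset)
    qed (use B in auto)
    have sq: "(h z)\<^sup>2 = 1" if "z \<in> ?B" for z
      using s0(2)[of z] B[of z] that by (auto simp: h_def power_divide)
    \<comment> \<open>A continuous function with values 1 and -1 on a convex half disc.\<close>
    have "h constant_on ?B"
    proof (rule continuous_finite_range_constant[OF _ cont])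
      show "connected ?B"
        by (intro convex_connected convex_Int convex_ball convex_halfspace_Im_gt)
      have "h ` ?B \<subseteq> {1, -1}"
        using sq unfolding power2_eq_1_iff by blast
      thus "finite (h ` ?B)" by (rule finite_subset) simp
    qed
    then obtain \<epsilon> where \<epsilon>: "\<And>z. z \<in> ?B \<Longrightarrow> h z = \<epsilon>" by (auto simp: constant_on_def)
    have "\<forall>\<^sub>F z in nhds x. z \<in> ball x e"
      using e(1) by (intro eventually_nhds_in_open) auto
    then obtain z where "z \<in> ?B" using upper_near_real[OF x] by blast
    hence "\<epsilon>\<^sup>2 = 1" using \<epsilon>[of z] sq[of z] by simp
    moreover have "s0 z = \<epsilon> * csqrt (u z)" if "z \<in> ?B" for z
      using \<epsilon>[OF that] B[of z] that by (simp add: h_def field_simps)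
    ultimately have "Q x e \<epsilon>" unfolding Q_def using e(1) B(1,2) by blast
    thus ?thesis by blast
  qed
  hence "\<forall>x. \<exists>e \<epsilon>. x \<in> D \<and> Im x = 0 \<longrightarrow> Q x e \<epsilon>" by blast
  then obtain e \<epsilon> where "\<forall>x. x \<in> D \<and> Im x = 0 \<longrightarrow> Q x (e x) (\<epsilon> x)" by metis
  hence e\<epsilon>: "\<And>x. x \<in> D \<Longrightarrow> Im x = 0 \<Longrightarrow> e x > 0"
    "\<And>x. x \<in> D \<Longrightarrow> Im x = 0 \<Longrightarrow> ball x (e x) \<subseteq> D"
    "\<And>x z. x \<in> D \<Longrightarrow> Im x = 0 \<Longrightarrow> z \<in> ball x (e x) \<Longrightarrow> Re (u z) > 0"
    "\<And>x. x \<in> D \<Longrightarrow> Im x = 0 \<Longrightarrow> (\<epsilon> x)\<^sup>2 = 1"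
    "\<And>x z. x \<in> D \<Longrightarrow> Im x = 0 \<Longrightarrow> z \<in> ball x (e x) \<Longrightarrow> 0 < Im z \<Longrightarrow> s0 z = \<epsilon> x * csqrt (u z)"
    unfolding Q_def by auto
  \<comment> \<open>The half discs at x and y overlap above y, so the sign is locally constant along
    the real axis. No agreement between different real intervals is claimed.\<close>
  have \<epsilon>_eq: "\<epsilon> y = \<epsilon> x" if x: "x \<in> D" "Im x = 0" and y: "y \<in> ball x (e x)" "Im y = 0" for x y
  proof -
    have "y \<in> D" using e\<epsilon>(2)[OF x] y by blast
    have "\<forall>\<^sub>F z in nhds y. z \<in> ball x (e x) \<inter> ball y (e y)"
      using y e\<epsilon>(1)[OF \<open>y \<in> D\<close> y(2)] by (intro eventually_nhds_in_open) auto
    from upper_near_real[OF \<open>y \<in> D\<close> y(2) this] obtain z where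
      z: "z \<in> D" "0 < Im z" "z \<in> ball x (e x)" "z \<in> ball y (e y)" by blast
    have "\<epsilon> y * csqrt (u z) = \<epsilon> x * csqrt (u z)"
      using e\<epsilon>(5)[OF x z(3,2)] e\<epsilon>(5)[OF \<open>y \<in> D\<close> y(2) z(4,2)] by simp
    thus ?thesis using nz[OF z(1)] by simp
  qed
  \<comment> \<open>The second branch is relevant only for real z; the lower half is supplied by
    reflection afterwards.\<close>
  define f where "f = (\<lambda>z. if 0 < Im z then s0 z else \<epsilon> z * csqrt (u z))"
  have f_sq: "(f z)\<^sup>2 = u z" if "z \<in> D" "0 \<le> Im z" for z
    using s0(2)[of z] e\<epsilon>(4)[of z] that by (auto simp: f_def power_mult_distrib)
  have f_local: "f z = \<epsilon> x * csqrt (u z)"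
    if "x \<in> D" "Im x = 0" "z \<in> ball x (e x)" "0 \<le> Im z" for x z
    using e\<epsilon>(5)[OF that(1-3)] \<epsilon>_eq[OF that(1-3)] that(4) by (auto simp: f_def)
  have f_real: "f x \<in> \<real>" if x: "x \<in> D" "Im x = 0" for x
  proof -
    have "cnj x = x" using x(2) by (simp add: complex_eq_iff)
    hence "cnj (u x) = u x" using u x(1) by (metis reflective_def)
    hence "Im (u x) = 0" by (simp add: complex_eq_iff)
    hence "csqrt (u x) = of_real (sqrt (Re (u x)))"
      using pos[OF x] by (intro csqrt_of_real_nonneg) auto
    moreover have "\<epsilon> x \<in> \<real>"
      using e\<epsilon>(4)[OF x] by (auto simp: power2_eq_1_iff)
    ultimately show ?thesis using x(2) by (simp add: f_def)
  qed
  have cont: "continuous_on (D \<inter> {z. 0 \<le> Im z}) f"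
    unfolding continuous_on_def
  proof
    fix x assume x: "x \<in> D \<inter> {z. 0 \<le> Im z}"
    let ?F = "at x within D \<inter> {z. 0 \<le> Im z}"
    show "(f \<longlongrightarrow> f x) ?F"
    proof (cases "Im x = 0")
      case True
      have "u analytic_on {x}" using reflective_analytic[OF u] x by blast
      moreover have "u x \<notin> \<real>\<^sub>\<le>\<^sub>0" using pos[of x] x True by (auto simp: complex_nonpos_Reals_iff)
      ultimately have "(\<lambda>z. \<epsilon> x * csqrt (u z)) analytic_on {x}"
        by (intro analytic_intros) auto
      hence "((\<lambda>z. \<epsilon> x * csqrt (u z)) \<longlongrightarrow> \<epsilon> x * csqrt (u x)) ?F"
        by (meson Lim_at_imp_Lim_at_within analytic_at_imp_isCont isContD)
      moreover have "\<epsilon> x * csqrt (u x) = f x" using True by (simp add: f_def)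
      moreover have "\<forall>\<^sub>F z in ?F. \<epsilon> x * csqrt (u z) = f z"
      proof -
        have "\<forall>\<^sub>F z in nhds x. z \<in> ball x (e x)"
          using e\<epsilon>(1)[of x] x True by (intro eventually_nhds_in_open) auto
        thus ?thesis unfolding eventually_at_filter
        proof eventually_elim
          case (elim z)
          show ?case using f_local[of x z] x True elim by auto
        qed
      qed
      ultimately show ?thesis using Lim_transform_eventually by metis
    next
      case False
      hence x': "x \<in> ?U" using x by auto
      have "isCont s0 x"
        using s0(1) x' open_upper by (metis analytic_at analytic_at_imp_isCont)
      hence "(s0 \<longlongrightarrow> s0 x) ?F"
        by (meson Lim_at_imp_Lim_at_within isContD)
      moreover have "\<forall>\<^sub>F z in ?F. s0 z = f z"
      proof -
        have "\<forall>\<^sub>F z in nhds x. z \<in> ?U"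
          using x' open_upper by (intro eventually_nhds_in_open)
        thus ?thesis unfolding eventually_at_filter
          by eventually_elim (simp add: f_def)
      qed
      ultimately have "(f \<longlongrightarrow> s0 x) ?F" by (rule Lim_transform_eventually)
      thus ?thesis using x' by (simp add: f_def)
    qed
  qed
  define s where "s = (\<lambda>z. if 0 \<le> Im z then f z else cnj (f (cnj z)))"
  have "s holomorphic_on D"
    unfolding s_def
  proof (rule Schwarz_reflection[OF open_D _ _ cont])
    show "cnj ` D \<subseteq> D" using cnj_D by simp
    have "f holomorphic_on ?U \<longleftrightarrow> s0 holomorphic_on ?U"
      by (rule holomorphic_cong) (auto simp: f_def)
    thus "f holomorphic_on ?U" using s0(1) by simp
  qed (use f_real in \<open>simp add: complex_is_Real_iff\<close>)
  moreover have "s (cnj z) = cnj (s z)" if z: "z \<in> D" for z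
  proof (cases "Im z = 0")
    case True
    hence "cnj z = z" by (simp add: complex_eq_iff)
    moreover have "cnj (f z) = f z" using f_real[OF z True] by (simp add: Reals_cnj_iff)
    ultimately show ?thesis using True by (simp add: s_def)
  qed (auto simp: s_def)
  ultimately have "reflective s" by (simp add: reflective_def)
  moreover have "(s z)\<^sup>2 = u z" if z: "z \<in> D" for z
  proof (cases "0 \<le> Im z")
    case True
    thus ?thesis using f_sq[OF z] by (simp add: s_def)
  next
    case False
    have "(s z)\<^sup>2 = cnj ((f (cnj z))\<^sup>2)" using False by (simp add: s_def)
    also have "\<dots> = cnj (u (cnj z))" using f_sq[of "cnj z"] z False by simp
    also have "\<dots> = u z" using u z by (simp add: reflective_def)
    finally show ?thesis .
  qed
  ultimately show ?thesis by (rule that)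
qed

lemma reflective_sum_squares:
  assumes "\<And>b. b \<in> B \<Longrightarrow> reflective (F b)"
  shows "reflective (\<lambda>z. \<Sum>b\<in>B. (F b z)\<^sup>2)"
  unfolding reflective_def
proof (intro conjI ballI)
  show "(\<lambda>z. \<Sum>b\<in>B. (F b z)\<^sup>2) holomorphic_on D"
    using assms by (intro holomorphic_intros) (simp add: reflective_def)
  fix z assume "z \<in> D"
  hence "F b (cnj z) = cnj (F b z)" if "b \<in> B" for b
    using assms[OF that] by (simp add: reflective_def)
  thus "(\<Sum>b\<in>B. (F b (cnj z))\<^sup>2) = cnj (\<Sum>b\<in>B. (F b z)\<^sup>2)"
    by simp
qed

lemma cnj_conj_holomorphic_D: "f holomorphic_on D \<Longrightarrow> cnj_conj f holomorphic_on D"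
  using open_D cnj_D by (intro cnj_conj_holomorphic)

lemma holo_order_cnj_conj_D:
  "f holomorphic_on D \<Longrightarrow> p \<in> D \<Longrightarrow> holo_order (cnj_conj f) p = holo_order f (cnj p)"
  by (intro holo_order_cnj_conj analytic_at_D) auto

text \<open>Sparsity of the prescribed divisor is inherited from the zero set of a function already
  at hand.\<close>

lemma weierstrass_divisor_subset_zeros:
  assumes f: "f holomorphic_on D" "\<And>p. p \<in> D \<Longrightarrow> holo_order f p \<noteq> \<infinity>"
    and m: "\<And>p. p \<in> D \<Longrightarrow> m p > 0 \<Longrightarrow> holo_order f p \<noteq> 0"
  obtains W where "W holomorphic_on D" "\<And>p. p \<in> D \<Longrightarrow> holo_order W p = enat (m p)"
proof -
  have "{z \<in> D. m z > 0} \<subseteq> {z \<in> D. f z = 0}"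
    using m holo_order_zero[OF analytic_at_D[OF f(1)]] by blast
  with sparse_zeros[OF open_D f] have "{z \<in> D. m z > 0} sparse_in D"
    by (rule sparse_in_subset2)
  from weierstrass_divisor[OF open_D this] that show ?thesis by blast
qed

text \<open>The divisor e is not assumed symmetric. W and its reflection together have the divisor
  of G, and on the real axis their product is the squared modulus of W, which fixes the sign of the
  quotient u.\<close>

lemma factor_through_divisor:
  assumes G: "reflective G" "\<And>p. p \<in> D \<Longrightarrow> holo_order G p = enat (e p + e (cnj p))"
    and nonneg: "\<And>x. x \<in> D \<Longrightarrow> Im x = 0 \<Longrightarrow> 0 \<le> Re (G x)"
  obtains P where "P holomorphic_on D" "\<And>z. z \<in> D \<Longrightarrow> P z * cnj_conj P z = G z"
    "\<And>p. p \<in> D \<Longrightarrow> holo_order P p = enat (e p)"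
proof -
  have hol_G: "G holomorphic_on D" using G(1) by (simp add: reflective_def)
  obtain W where W: "W holomorphic_on D" "\<And>p. p \<in> D \<Longrightarrow> holo_order W p = enat (e p)"
    by (rule weierstrass_divisor_subset_zeros[OF hol_G, of e]) (simp_all add: G(2) zero_enat_def)
  define V where "V = (\<lambda>z. W z * cnj_conj W z)"
  have Wc: "cnj_conj W holomorphic_on D" by (rule cnj_conj_holomorphic_D[OF W(1)])
  have V: "V holomorphic_on D" unfolding V_def by (intro holomorphic_intros W Wc)
  have ord_V: "holo_order V p = enat (e p + e (cnj p))" if p: "p \<in> D" for p
  proof -
    have "holo_order V p = holo_order W p + holo_order (cnj_conj W) p"
      unfolding V_def using p by (intro holo_order_mult analytic_at_D W Wc)
    thus ?thesis using p W(2)[of "cnj p"] by (simp add: holo_order_cnj_conj_D W)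
  qed
  obtain u where u: "u holomorphic_on D" "\<And>p. p \<in> D \<Longrightarrow> u p \<noteq> 0" "\<And>p. p \<in> D \<Longrightarrow> G p = u p * V p"
    by (rule holomorphic_quotient_same_order[OF open_D hol_G V]) (simp_all add: G(2) ord_V)
  have cnj_V: "cnj (V (cnj z)) = V z" for z
    by (simp add: V_def cnj_conj_def mult.commute)
  \<comment> \<open>G = u * V determines u directly only off the zeros of V; comparing germs covers
    the zeros too.\<close>
  have u_sym: "cnj_conj u z = u z" if z: "z \<in> D" for z
  proof (rule holo_order_cancel[where f = "cnj_conj u" and g = u and w = V])
    show "cnj_conj u analytic_on {z}" "u analytic_on {z}" "V analytic_on {z}"
      using z u(1) V by (auto intro!: analytic_at_D cnj_conj_holomorphic_D)
    show "holo_order V z \<noteq> \<infinity>" using ord_V[OF z] by simp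
    show "\<forall>\<^sub>F w in nhds z. cnj_conj u w * V w = u w * V w"
      using nhds_D[OF z]
    proof eventually_elim
      case (elim w)
      have "cnj_conj u w * V w = cnj (u (cnj w) * V (cnj w))"
        by (simp add: cnj_conj_def cnj_V)
      also have "\<dots> = cnj (G (cnj w))" using u(3)[of "cnj w"] elim by simp
      also have "\<dots> = G w" using G(1) elim by (simp add: reflective_def)
      also have "\<dots> = u w * V w" using u(3) elim by simp
      finally show ?case .
    qed
  qed
  have refl_u: "reflective u"
    unfolding reflective_def using u(1) u_sym by (metis cnj_conj_def complex_cnj_cnj)
  have u_pos: "0 < Re (u x)" if x: "x \<in> D" "Im x = 0" for x
  proof -
    have real_point: "Im (u y) = 0" if "y \<in> D" "Im y = 0" for y
    proof -
      have "cnj y = y" using that(2) by (simp add: complex_eq_iff)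
      hence "cnj (u y) = u y" using u_sym[OF that(1)] by (simp add: cnj_conj_def)
      thus ?thesis by (simp add: complex_eq_iff)
    qed
    \<comment> \<open>V may vanish at x, so the sign is read off at nearby real points and passed to
      the limit. Being real and nonzero, u x is then positive.\<close>
    have "u x \<in> {z. 0 \<le> Re z}"
    proof (rule limit_along_Reals[OF analytic_at_D[OF u(1) x(1)] x(2)])
      show "closed {z. 0 \<le> Re z}" by (rule closed_halfspace_Re_ge)
      have "\<forall>\<^sub>F z in at x. V z \<noteq> 0"
        by (rule holo_order_finite_eventually_nonzero[OF analytic_at_D[OF V x(1)]]) (simp add: ord_V x)
      moreover have "\<forall>\<^sub>F z in at x. z \<in> D"
        using nhds_D[OF x(1)] by (simp add: eventually_nhds_conv_at)
      ultimately show "\<forall>\<^sub>F z in at x. z \<in> \<real> \<longrightarrow> u z \<in> {z. 0 \<le> Re z}"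
      proof eventually_elim
        case (elim z)
        show ?case
        proof
          assume "z \<in> \<real>"
          hence z: "Im z = 0" "cnj z = z" by (simp_all add: complex_is_Real_iff complex_eq_iff)
          have V_eq: "V z = of_real ((norm (W z))\<^sup>2)"
            using z(2) using complex_norm_square[of "W z"] by (simp add: V_def cnj_conj_def)
          hence "(norm (W z))\<^sup>2 > 0" using elim(1) by auto
          moreover have "0 \<le> Re (G z)" using nonneg elim(2) z(1) by blast
          moreover have "Re (G z) = Re (u z) * (norm (W z))\<^sup>2"
            using u(3)[OF elim(2)] V_eq by simp
          ultimately show "u z \<in> {z. 0 \<le> Re z}"
            by (simp add: zero_le_mult_iff)
        qed
      qed
    qed
    moreover have "u x \<noteq> 0" "Im (u x) = 0" using u(2) real_point x by auto
    ultimately show ?thesis by (auto simp: complex_eq_iff less_le)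
  qed
  obtain s where s: "reflective s" "\<And>z. z \<in> D \<Longrightarrow> (s z)\<^sup>2 = u z"
    using reflective_sqrt[OF refl_u u(2) u_pos] by blast
  show ?thesis
  proof (rule that[of "\<lambda>z. W z * s z"])
    show "(\<lambda>z. W z * s z) holomorphic_on D"
      using s(1) by (intro holomorphic_intros W) (simp add: reflective_def)
    show "W z * s z * cnj_conj (\<lambda>z. W z * s z) z = G z" if z: "z \<in> D" for z
    proof -
      have "cnj (s (cnj z)) = s z" using s(1) z by (simp add: reflective_def)
      hence "W z * s z * cnj_conj (\<lambda>z. W z * s z) z = (s z)\<^sup>2 * V z"
        by (simp add: cnj_conj_def V_def power2_eq_square)
      thus ?thesis using s(2) u(3) z by simp
    qed
    show "holo_order (\<lambda>z. W z * s z) p = enat (e p)" if p: "p \<in> D" for p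
    proof -
      have "s p \<noteq> 0" using s(2)[OF p] u(2)[OF p] by auto
      have "holo_order (\<lambda>z. W z * s z) p = holo_order W p + holo_order s p"
        by (intro holo_order_mult analytic_at_D[OF W(1) p] reflective_analytic[OF s(1) p])
      also have "holo_order s p = 0"
        using \<open>s p \<noteq> 0\<close> reflective_analytic[OF s(1) p] by (simp add: holo_order_nonzero)
      finally show ?thesis using W(2)[OF p] by simp
    qed
  qed
qed

lemma sum_squares_factorization:
  assumes B: "finite B" "B \<noteq> {}" and F: "\<And>b. b \<in> B \<Longrightarrow> reflective (F b)"
  obtains P where "P holomorphic_on D" "\<And>z. z \<in> D \<Longrightarrow> P z * cnj_conj P z = (\<Sum>b\<in>B. (F b z)\<^sup>2)"
    "\<And>p. p \<in> D \<Longrightarrow>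
      min (holo_order P p) (holo_order (cnj_conj P) p) = Min ((\<lambda>b. holo_order (F b) p) ` B)"
proof -
  define G where "G = (\<lambda>z. \<Sum>b\<in>B. (F b z)\<^sup>2)"
  define d where "d = (\<lambda>p. Min ((\<lambda>b. holo_order (F b) p) ` B))"
  have G: "reflective G" unfolding G_def by (rule reflective_sum_squares[OF F])
  have d_le: "d p \<le> holo_order (F b) p" if "b \<in> B" for p b
    unfolding d_def using B that by (intro Min_le) auto
  have d_attained: "\<exists>b\<in>B. d p = holo_order (F b) p" for p
  proof -
    have "d p \<in> (\<lambda>b. holo_order (F b) p) ` B" unfolding d_def using B by (intro Min_in) auto
    thus ?thesis by blast
  qed
  have d_cnj: "d (cnj p) = d p" if "p \<in> D" for p
    unfolding d_def by (intro arg_cong[of _ _ Min] image_cong refl reflective_holo_order_cnj F that)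
  have ord_G_cnj: "holo_order G (cnj p) = holo_order G p" if "p \<in> D" for p
    by (rule reflective_holo_order_cnj[OF G that])
  have ord_G_ge: "enat (2 * n) \<le> holo_order G p" if p: "p \<in> D" and n: "enat n \<le> d p" for p n
    unfolding G_def
  proof (rule holo_order_sum_ge)
    fix b assume b: "b \<in> B"
    have an: "F b analytic_on {p}" by (rule reflective_analytic[OF F[OF b] p])
    thus "(\<lambda>z. (F b z)\<^sup>2) analytic_on {p}" by (intro analytic_intros)
    have "enat n \<le> holo_order (F b) p" using d_le[OF b, of p] n by (rule order.trans[rotated])
    hence "enat n + enat n \<le> holo_order (F b) p + holo_order (F b) p" by (intro add_mono)
    also have "\<dots> = holo_order (\<lambda>z. (F b z)\<^sup>2) p"
      unfolding power2_eq_square by (rule holo_order_mult[OF an an, symmetric])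
    finally show "enat (2 * n) \<le> holo_order (\<lambda>z. (F b z)\<^sup>2) p" by (simp add: mult_2)
  qed
  have ord_G_real: "holo_order G x = enat (2 * n)" if x: "x \<in> D" "Im x = 0" and n: "d x = enat n" for x n
  proof -
    obtain b0 where "b0 \<in> B" "d x = holo_order (F b0) x" using d_attained by blast
    thus ?thesis unfolding G_def using d_le[of _ x] n
      by (intro holo_order_sum_squares_real[OF B(1) F x, where n = n and ?b0.0 = b0]) auto
  qed
  show ?thesis
  proof (cases "\<exists>p\<in>D. holo_order G p = \<infinity>")
    case False
    define g where "g = (\<lambda>p. the_enat (holo_order G p))"
    define n where "n = (\<lambda>p. the_enat (d p))"
    have g: "holo_order G p = enat (g p)" if "p \<in> D" for p
      using False that by (cases "holo_order G p") (auto simp: g_def)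
    have n: "d p = enat (n p)" if p: "p \<in> D" for p
    proof (cases "d p")
      case infinity
      \<comment> \<open>If all components vanished near p, G would have order at least 2 * (g p +
        1), more than its actual order g p.\<close>
      hence "enat (2 * Suc (g p)) \<le> holo_order G p" by (intro ord_G_ge p) simp
      thus ?thesis using g[OF p] by simp
    qed (simp add: n_def)
    have ng: "2 * n p \<le> g p" if "p \<in> D" for p
      using ord_G_ge[OF that, of "n p"] n[OF that] g[OF that] by simp
    have n_cnj: "n (cnj p) = n p" "g (cnj p) = g p" if "p \<in> D" for p
      using d_cnj[OF that] ord_G_cnj[OF that] by (simp_all add: n_def g_def)
    \<comment> \<open>As 2 * n p <= g p, the smaller of n p and g p - n p is n p. Real points fall
      under the second branch, consistently because g p = 2 * n p there.\<close>
    define e where "e = (\<lambda>p. if 0 < Im p then g p - n p else n p)"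
    have e_sum: "e p + e (cnj p) = g p" if p: "p \<in> D" for p
    proof -
      consider "Im p > 0" | "Im p < 0" | "Im p = 0" by linarith
      thus ?thesis
      proof cases
        case 3
        hence "2 * n p = g p" using ord_G_real[OF p 3 n[OF p]] g[OF p] by simp
        thus ?thesis using 3 n_cnj[OF p] by (simp add: e_def)
      qed (use ng[OF p] n_cnj[OF p] in \<open>auto simp: e_def\<close>)
    qed
    have "0 \<le> Re (G x)" if x: "x \<in> D" "Im x = 0" for x
    proof -
      have "0 \<le> Re ((F b x)\<^sup>2)" if b: "b \<in> B" for b
      proof -
        have "cnj x = x" using x(2) by (simp add: complex_eq_iff)
        hence "cnj (F b x) = F b x" using F[OF b] x(1) by (metis reflective_def)
        hence "Im (F b x) = 0" by (simp add: complex_eq_iff)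
        thus ?thesis by simp
      qed
      thus ?thesis unfolding G_def Re_sum by (rule sum_nonneg)
    qed
    from factor_through_divisor[OF G _ this, of e] g e_sum
    obtain P where P: "P holomorphic_on D" "\<And>z. z \<in> D \<Longrightarrow> P z * cnj_conj P z = G z"
      "\<And>p. p \<in> D \<Longrightarrow> holo_order P p = enat (e p)" by metis
    show ?thesis
    proof (rule that[OF P(1)])
      show "P z * cnj_conj P z = (\<Sum>b\<in>B. (F b z)\<^sup>2)" if "z \<in> D" for z
        using P(2)[OF that] by (simp add: G_def)
      fix p assume p: "p \<in> D"
      have "min (enat (e p)) (enat (e (cnj p))) = enat (n p)"
        using ng[OF p] n_cnj[OF p] by (auto simp: e_def min_def)
      hence "min (holo_order P p) (holo_order (cnj_conj P) p) = d p"
        using p P(3)[of p] P(3)[of "cnj p"] n[OF p]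
        by (simp add: holo_order_cnj_conj_D[OF P(1)])
      thus "min (holo_order P p) (holo_order (cnj_conj P) p) = Min ((\<lambda>b. holo_order (F b) p) ` B)"
        by (simp add: d_def)
    qed
  next
    case True
    then obtain p0 where p0: "p0 \<in> D" "holo_order G p0 = \<infinity>" by blast
    hence G0: "G z = 0" if "z \<in> D" for z by (rule reflective_identity[OF G _ _ that])
    show ?thesis
    proof (cases "\<exists>b\<in>B. \<exists>p\<in>D. holo_order (F b) p \<noteq> \<infinity>")
      case False
      show ?thesis
      proof (rule that[of "\<lambda>_. 0"])
        fix p assume p: "p \<in> D"
        have "(\<lambda>b. holo_order (F b) p) ` B = {\<infinity>}" using False p B(2) by auto
        thus "min (holo_order (\<lambda>_. 0) p) (holo_order (cnj_conj (\<lambda>_. 0)) p) =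
          Min ((\<lambda>b. holo_order (F b) p) ` B)"
          by (simp add: holo_order_def cnj_conj_def [abs_def])
      qed (use G0 in \<open>auto simp: G_def\<close>)
    next
      case True
      then obtain b0 q where b0: "b0 \<in> B" "q \<in> D" "holo_order (F b0) q \<noteq> \<infinity>" by blast
      have fin: "holo_order (F b0) p \<noteq> \<infinity>" if p: "p \<in> D" for p
      proof
        assume "holo_order (F b0) p = \<infinity>"
        hence "F b0 z = 0" if "z \<in> D" for z
          by (rule reflective_identity[OF F[OF b0(1)] p _ that])
        hence "\<forall>\<^sub>F z in nhds q. F b0 z = 0" using nhds_D[OF b0(2)] by (rule eventually_mono[rotated])
        thus False using b0(3) by (simp only: holo_order_eq_infinity_iff simp_thms)
      qed
      define n where "n = (\<lambda>p. the_enat (d p))"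
      have n: "d p = enat (n p)" if p: "p \<in> D" for p
        using d_le[OF b0(1), of p] fin[OF p] by (cases "d p") (auto simp: n_def)
      \<comment> \<open>At a real point G would have the finite order 2 * n x, although it vanishes
        identically. Hence D splits into two separate halves.\<close>
      have nonreal: "Im x \<noteq> 0" if x: "x \<in> D" for x
      proof
        assume "Im x = 0"
        from ord_G_real[OF x this n[OF x]] have "holo_order G x = enat (2 * n x)" .
        moreover have "\<forall>\<^sub>F z in nhds x. G z = 0"
          using nhds_D[OF x] by eventually_elim (rule G0)
        ultimately show False by (simp add: holo_order_eq_infinity_iff[THEN iffD2])
      qed
      have hol_F: "F b0 holomorphic_on D" using F[OF b0(1)] by (simp add: reflective_def)
      have "holo_order (F b0) p \<noteq> 0" if p: "p \<in> D" "n p > 0" for p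
        using d_le[OF b0(1), of p] n[OF p(1)] p(2) by (auto simp: zero_enat_def)
      with weierstrass_divisor_subset_zeros[OF hol_F fin, of n]
      obtain W where W: "W holomorphic_on D" "\<And>p. p \<in> D \<Longrightarrow> holo_order W p = enat (n p)"
        by blast
      \<comment> \<open>Without real points the jump is harmless. Of z and cnj z one lies above, so
        the product vanishes, and at each conjugate pair the orders are infinity and d, with minimum
        d.\<close>
      define P where "P = (\<lambda>z. if 0 < Im z then 0 else W z)"
      have upper: "\<forall>\<^sub>F z in nhds p. P z = 0" if "0 < Im p" for p
      proof -
        have "\<forall>\<^sub>F z in nhds p. z \<in> {z. 0 < Im z}"
          using that by (intro eventually_nhds_in_open open_halfspace_Im_gt) simp
        thus ?thesis by eventually_elim (simp add: P_def)
      qed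
      have lower: "\<forall>\<^sub>F z in nhds p. P z = W z" if "Im p < 0" for p
      proof -
        have "\<forall>\<^sub>F z in nhds p. z \<in> {z. Im z < 0}"
          using that by (intro eventually_nhds_in_open open_halfspace_Im_lt) simp
        thus ?thesis by eventually_elim (simp add: P_def)
      qed
      have "P analytic_on {p}" if p: "p \<in> D" for p
      proof (cases "0 < Im p")
        case True
        show ?thesis using analytic_at_cong[OF upper[OF True] refl] by simp
      next
        case False
        hence "Im p < 0" using nonreal[OF p] by simp
        show ?thesis using analytic_at_cong[OF lower[OF \<open>Im p < 0\<close>] refl] analytic_at_D[OF W(1) p] by simp
      qed
      hence hol_P: "P holomorphic_on D"
        by (intro analytic_imp_holomorphic) (subst analytic_on_analytic_at, blast)
      have ord_upper: "holo_order P p = \<infinity>" if "0 < Im p" for p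
        using upper[OF that] by (simp only: holo_order_eq_infinity_iff)
      have ord_lower: "holo_order P p = d p" if "p \<in> D" "Im p < 0" for p
        using holo_order_cong[OF lower[OF that(2)]] W(2)[OF that(1)] n[OF that(1)] by simp
      show ?thesis
      proof (rule that[OF hol_P])
        fix z assume z: "z \<in> D"
        have "P z = 0 \<or> P (cnj z) = 0" using nonreal[OF z] by (auto simp: P_def)
        thus "P z * cnj_conj P z = (\<Sum>b\<in>B. (F b z)\<^sup>2)"
          using G0[OF z] by (auto simp: G_def cnj_conj_def)
      next
        fix p assume p: "p \<in> D"
        have "min (holo_order P p) (holo_order (cnj_conj P) p) = d p"
        proof (cases "0 < Im p")
          case True
          thus ?thesis using p ord_lower[of "cnj p"]
            by (simp add: holo_order_cnj_conj_D[OF hol_P] ord_upper d_cnj)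
        next
          case False
          hence "Im p < 0" using nonreal[OF p] by simp
          thus ?thesis using p ord_upper[of "cnj p"]
            by (simp add: holo_order_cnj_conj_D[OF hol_P] ord_lower)
        qed
        thus "min (holo_order P p) (holo_order (cnj_conj P) p) = Min ((\<lambda>b. holo_order (F b) p) ` B)"
          by (simp add: d_def)
      qed
    qed
  qed
qed

text \<open>H1 and H2 are the symmetric solutions of P = H1 + \<i> H2, namely the half sum of P and
  its reflection, and their difference over 2 \<i>.\<close>

theorem sum_of_two_squares:
  assumes "finite B" "B \<noteq> {}" "\<And>b. b \<in> B \<Longrightarrow> reflective (F b)"
  obtains H1 H2 where "reflective H1" "reflective H2"
    "\<And>z. z \<in> D \<Longrightarrow> (H1 z)\<^sup>2 + (H2 z)\<^sup>2 = (\<Sum>b\<in>B. (F b z)\<^sup>2)"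
    "\<And>p. p \<in> D \<Longrightarrow> min (holo_order H1 p) (holo_order H2 p) = Min ((\<lambda>b. holo_order (F b) p) ` B)"
proof -
  obtain P where P: "P holomorphic_on D" "\<And>z. z \<in> D \<Longrightarrow> P z * cnj_conj P z = (\<Sum>b\<in>B. (F b z)\<^sup>2)"
    "\<And>p. p \<in> D \<Longrightarrow>
      min (holo_order P p) (holo_order (cnj_conj P) p) = Min ((\<lambda>b. holo_order (F b) p) ` B)"
    using sum_squares_factorization[where F = F, OF assms] by blast
  have Pc: "cnj_conj P holomorphic_on D" by (rule cnj_conj_holomorphic_D[OF P(1)])
  let ?H1 = "\<lambda>z. (P z + cnj_conj P z) / 2" and ?H2 = "\<lambda>z. (P z - cnj_conj P z) / (2 * \<i>)"
  show ?thesis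
  proof (rule that[of ?H1 ?H2])
    show "reflective ?H1" unfolding reflective_def
      by (intro conjI ballI holomorphic_intros P(1) Pc) (simp_all add: cnj_conj_def)
    show "reflective ?H2" unfolding reflective_def
      by (intro conjI ballI holomorphic_intros P(1) Pc) (simp_all add: cnj_conj_def field_simps)
    show "(?H1 z)\<^sup>2 + (?H2 z)\<^sup>2 = (\<Sum>b\<in>B. (F b z)\<^sup>2)" if "z \<in> D" for z
    proof -
      have "(?H1 z)\<^sup>2 + (?H2 z)\<^sup>2 = P z * cnj_conj P z"
        by (simp add: power_divide power_mult_distrib) (simp add: power2_eq_square field_simps)
      thus ?thesis using P(2)[OF that] by simp
    qed
    show "min (holo_order ?H1 p) (holo_order ?H2 p) = Min ((\<lambda>b. holo_order (F b) p) ` B)"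
      if p: "p \<in> D" for p
      using min_holo_order_half_sum_diff[OF analytic_at_D[OF P(1) p] analytic_at_D[OF Pc p]] P(3)[OF p]
      by simp
  qed
qed

end

section \<open>Composition algebras\<close>

text \<open>The laws shared by quaternions and octonions on which the argument rests; the class
  itself is purely syntactic. The left alternative law replaces associativity, and three basis
  elements leave two imaginary units.\<close>

locale composition_algebra =
  fixes dim_type :: "'a::hypercomplex itself"
  assumes add_mult: "\<And>x y z :: 'a. (x + y) * z = x * z + y * z"
    and mult_add: "\<And>x y z :: 'a. x * (y + z) = x * y + x * z"
    and scaleR_mult: "\<And>r x y. (r *\<^sub>R x) * y = r *\<^sub>R (x * (y :: 'a))"
    and mult_scaleR: "\<And>r x y. x * (r *\<^sub>R y) = r *\<^sub>R (x * (y :: 'a))"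
    and one_Basis: "(1 :: 'a) \<in> Basis"
    and mult_one: "\<And>x :: 'a. 1 * x = x" "\<And>x :: 'a. x * 1 = x"
    and hconj_eq: "\<And>x :: 'a. hconj x = (2 * inner x 1) *\<^sub>R 1 - x"
    and mult_hconj: "\<And>x :: 'a. x * hconj x = (inner x x) *\<^sub>R 1"
    and left_alternative: "\<And>x y :: 'a. x * (x * y) = (x * x) * y"
    and card_Basis: "3 \<le> card (Basis :: 'a set)"

context composition_algebra
begin

lemma zero_mult: "0 * x = (0 :: 'a)"
  using add_mult[of 0 0 x] by simp

lemma mult_zero: "x * 0 = (0 :: 'a)"
  using mult_add[of x 0 0] by simp

lemma minus_mult: "(- x) * y = - (x * y :: 'a)"
  using add_mult[of x "- x" y] by (simp add: zero_mult eq_neg_iff_add_eq_0 add.commute)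

lemma mult_minus: "x * (- y) = - (x * y :: 'a)"
  using mult_add[of x y "- y"] by (simp add: mult_zero eq_neg_iff_add_eq_0 add.commute)

lemma diff_mult: "(x - y) * z = x * z - y * (z :: 'a)"
  using add_mult[of x "- y" z] by (simp add: minus_mult)

lemma mult_diff: "x * (y - z) = x * y - x * (z :: 'a)"
  using mult_add[of x y "- z"] by (simp add: mult_minus)

lemmas bilinear_simps = zero_mult mult_zero minus_mult mult_minus diff_mult mult_diff add_mult mult_add
  scaleR_mult mult_scaleR mult_one

lemma inner_one_one: "inner (1::'a) 1 = 1"
  using one_Basis by (simp add: inner_Basis)

text \<open>Polarization of \<open>mult_hconj\<close>.\<close>

lemma mult_hconj_sym: "x * hconj y + y * hconj x = (2 * inner x y) *\<^sub>R (1 :: 'a)"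
proof -
  have h: "hconj (x + y) = hconj x + hconj y"
    by (simp add: hconj_eq inner_add_left algebra_simps)
  have "x * hconj x + (x * hconj y + y * hconj x) + y * hconj y = (x + y) * hconj (x + y)"
    unfolding h by (simp add: bilinear_simps)
  also have "\<dots> = (inner x x + 2 * inner x y + inner y y) *\<^sub>R 1"
    unfolding mult_hconj by (simp add: inner_add_left inner_add_right inner_commute)
  finally show ?thesis unfolding mult_hconj by (simp add: algebra_simps)
qed

lemma square_eq: "x * x = (2 * inner x 1) *\<^sub>R x - (inner x x) *\<^sub>R (1 :: 'a)"
  using mult_hconj[of x] unfolding hconj_eq by (simp add: bilinear_simps algebra_simps)

lemma imag_units_iff: "I \<in> imag_units \<longleftrightarrow> inner I (1 :: 'a) = 0 \<and> inner I I = 1"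
proof
  assume "I \<in> imag_units"
  hence *: "(2 * inner I 1) *\<^sub>R I = (inner I I - 1) *\<^sub>R (1 :: 'a)"
    using square_eq[of I] by (simp add: imag_units_def algebra_simps)
  have **: "inner I 1 = 0"
  proof (rule ccontr)
    assume nz: "inner I 1 \<noteq> 0"
    have "I = (1 / (2 * inner I 1)) *\<^sub>R ((2 * inner I 1) *\<^sub>R I)" using nz by simp
    also have "\<dots> = ((inner I I - 1) / (2 * inner I 1)) *\<^sub>R 1" unfolding * by simp
    finally obtain c where c: "I = c *\<^sub>R 1" by blast
    \<comment> \<open>An imaginary unit with nonzero real part would be a real multiple of 1, and no
      real number has square -1.\<close>
    have "c * c + 1 = inner (I * I + 1) (1 :: 'a)"
      by (simp add: c bilinear_simps inner_add_left inner_one_one)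
    also have "\<dots> = 0" using \<open>I \<in> imag_units\<close> by (simp add: imag_units_def)
    finally show False using zero_le_square[of c] by linarith
  qed
  have "0 = inner ((inner I I - 1) *\<^sub>R (1 :: 'a)) 1"
    unfolding *[symmetric] ** by simp
  hence "inner I I = 1" by (simp add: inner_one_one)
  with ** show "inner I 1 = 0 \<and> inner I I = 1" by blast
qed (simp add: imag_units_def square_eq)

lemma imag_unit_mult_mult:
  assumes "I \<in> imag_units"
  shows "I * (I * x) = - (x :: 'a)"
  using assms unfolding left_alternative imag_units_def by (simp add: bilinear_simps)

lemma Basis_imag_units: "b \<in> Basis - {1} \<Longrightarrow> b \<in> (imag_units :: 'a set)"
  using one_Basis by (auto simp: imag_units_iff inner_Basis)

lemma uminus_imag_units: "I \<in> imag_units \<Longrightarrow> - I \<in> (imag_units :: 'a set)"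
  by (auto simp: imag_units_iff)

lemma imag_units_anticommute:
  assumes "I \<in> imag_units" "J \<in> imag_units" "inner I J = (0::real)"
  shows "I * J = - (J * I :: 'a)"
proof -
  have "I * hconj J + J * hconj I = 0"
    using mult_hconj_sym[of I J] assms(3) by simp
  moreover have "hconj I = - I" "hconj J = - J"
    using assms by (auto simp: hconj_eq imag_units_iff)
  ultimately show ?thesis
    by (simp add: bilinear_simps) (metis add.inverse_inverse add_eq_0_iff minus_unique)
qed

text \<open>Distinct basis elements other than 1 are orthogonal imaginary units, and orthogonal
  imaginary units anticommute.\<close>

lemma frame_exists:
  obtains i j :: 'a where "i \<in> Basis - {1}" "j \<in> Basis - {1}" "i \<noteq> j"
    "quaternionic_frame (span {1, i, j, i * j}) i j"
proof -
  have "2 \<le> card (Basis - {1 :: 'a})"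
    using card_Basis one_Basis by simp
  then obtain i j :: 'a where ij: "i \<in> Basis - {1}" "j \<in> Basis - {1}" "i \<noteq> j"
    by (metis (no_types, lifting) card_le_Suc0_iff_eq finite_Basis finite_Diff not_less_eq_eq numeral_2_eq_2)
  have "inner i j = 0" using ij by (simp add: inner_Basis)
  with ij Basis_imag_units imag_units_anticommute show ?thesis
    by (intro that[OF ij]) (auto simp: quaternionic_frame_def)
qed

end

section \<open>Quaternions and octonions as composition algebras\<close>

lemma cd_eq_iff: "x = y \<longleftrightarrow> cd_fst x = cd_fst y \<and> cd_snd x = cd_snd y"
  by (cases x; cases y) auto

lemma cd_mult_sel [simp]:
  "cd_fst (x * y) = cd_fst x * cd_fst y - hconj (cd_snd y) * cd_snd x"
  "cd_snd (x * y) = cd_snd y * cd_fst x + cd_snd x * hconj (cd_fst y)"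
  "cd_fst 1 = 1" "cd_snd 1 = 0" "cd_fst (hconj x) = hconj (cd_fst x)" "cd_snd (hconj x) = - cd_snd x"
  by (simp_all add: times_cd_def one_cd_def hconj_cd_def)

interpretation quat: composition_algebra "TYPE(quat)"
proof
  fix x y z :: quat and r :: real
  show "(x + y) * z = x * z + y * z" "x * (y + z) = x * y + x * z"
    by (simp_all add: cd_eq_iff hconj_complex_def algebra_simps)
  show "(r *\<^sub>R x) * y = r *\<^sub>R (x * y)" "x * (r *\<^sub>R y) = r *\<^sub>R (x * y)"
    by (simp_all add: cd_eq_iff hconj_complex_def scaleR_conv_of_real algebra_simps)
  show "(1 :: quat) \<in> Basis" by (auto simp: Basis_cd_def one_cd_def Basis_complex_def)
  show "1 * x = x" "x * 1 = x" by (simp_all add: cd_eq_iff hconj_complex_def)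
  show "hconj x = (2 * inner x 1) *\<^sub>R 1 - x"
    by (simp add: cd_eq_iff hconj_complex_def inner_cd_def complex_eq_iff inner_complex_def)
  show "x * hconj x = (inner x x) *\<^sub>R 1"
    by (simp add: cd_eq_iff hconj_complex_def inner_cd_def complex_eq_iff inner_complex_def algebra_simps)
  show "x * (x * y) = (x * x) * y"
    by (simp add: cd_eq_iff hconj_complex_def algebra_simps)
  have "{CD 1 0, CD \<i> 0, CD 0 1} \<subseteq> (Basis :: quat set)" by (auto simp: Basis_cd_def Basis_complex_def)
  from card_mono[OF finite_Basis this] show "3 \<le> card (Basis :: quat set)" by simp
qed

lemma quat_hconj:
  "hconj (x + y) = hconj x + hconj (y :: quat)" "hconj (x - y) = hconj x - hconj (y :: quat)"
  "hconj (- x) = - hconj (x :: quat)"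
  "hconj (r *\<^sub>R x) = r *\<^sub>R hconj x" "hconj (hconj x) = x" "hconj (x * y) = hconj y * hconj x"
  "hconj 1 = (1 :: quat)" "hconj 0 = (0 :: quat)"
  by (simp_all add: cd_eq_iff hconj_complex_def scaleR_conv_of_real)

interpretation octo: composition_algebra "TYPE(octo)"
proof
  fix x y z :: octo and r :: real
  show "(x + y) * z = x * z + y * z" "x * (y + z) = x * y + x * z"
    by (simp_all add: cd_eq_iff[of "_ :: octo"] quat.bilinear_simps quat_hconj)
  show "(r *\<^sub>R x) * y = r *\<^sub>R (x * y)" "x * (r *\<^sub>R y) = r *\<^sub>R (x * y)"
    by (simp_all add: cd_eq_iff[of "_ :: octo"] quat.bilinear_simps quat_hconj algebra_simps)
  show "(1 :: octo) \<in> Basis" using quat.one_Basis by (auto simp: Basis_cd_def[where 'a = quat] one_cd_def[where 'a = quat])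
  show "1 * x = x" "x * 1 = x"
    by (simp_all add: cd_eq_iff[of "_ :: octo"] quat.bilinear_simps quat_hconj)
  show "hconj x = (2 * inner x 1) *\<^sub>R 1 - x"
    by (simp add: cd_eq_iff[of "_ :: octo"] quat.hconj_eq inner_cd_def[where 'a = quat])
  \<comment> \<open>The second component of an octonion enters the product with its conjugate on the
    left, so the norm identity is needed in this order as well.\<close>
  have "hconj q * q = inner q q *\<^sub>R 1" for q :: quat
    using quat.mult_hconj[of "hconj q"] quat_hconj(5)[of q]
    by (simp add: quat.hconj_eq inner_diff_left inner_diff_right inner_commute quat.inner_one_one)
  thus "x * hconj x = (inner x x) *\<^sub>R 1"
    by (simp add: cd_eq_iff[of "_ :: octo"] quat.mult_hconj quat_hconj quat.bilinear_simps
        inner_cd_def[where 'a = quat] algebra_simps)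
  \<comment> \<open>Here both doublings are unfolded down to complex coordinates, where
    multiplication is commutative; the laws above unfold only the outer doubling.\<close>
  show "x * (x * y) = (x * x) * y"
    by (simp add: cd_eq_iff hconj_complex_def algebra_simps)
  have "{CD (CD 1 0) 0, CD (CD \<i> 0) 0, CD (CD 0 1) 0} \<subseteq> (Basis :: octo set)"
    by (auto simp: Basis_cd_def Basis_complex_def)
  from card_mono[OF finite_Basis this] show "3 \<le> card (Basis :: octo set)" by simp
qed

section \<open>Stem functions\<close>

lemma c_coord_c_scale: "c_coord b (c_scale z w) = z * c_coord b w"
  by (simp add: c_coord_def c_scale_def complex_eq_iff inner_diff_left inner_add_left)

lemma c_coord_add: "c_coord b (v + w) = c_coord b v + c_coord b w"
  by (simp add: c_coord_def complex_eq_iff inner_add_left)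

lemma bounded_linear_c_coord: "bounded_linear (c_coord (b :: 'a::hypercomplex))"
proof -
  have "linear (c_coord b)"
    by (rule linearI) (simp_all add: c_coord_def complex_eq_iff inner_add_left)
  moreover have "linear (c_coord b) \<Longrightarrow> bounded_linear (c_coord b)"
    by (simp add: linear_conv_bounded_linear)
  ultimately show ?thesis by blast
qed

text \<open>The tensor b times z, spanning the complex line through b; with b = 1 it is
  \<open>c_of_complex\<close>.\<close>

definition c_embed :: "'a::hypercomplex \<Rightarrow> complex \<Rightarrow> 'a complexified" where
  "c_embed b z = (Re z *\<^sub>R b, Im z *\<^sub>R b)"

lemma bounded_linear_c_embed: "bounded_linear (c_embed (b :: 'a::hypercomplex))"
proof -
  have "linear (c_embed b)"
    by (rule linearI) (simp_all add: c_embed_def scaleR_add_left)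
  thus ?thesis by (simp add: linear_conv_bounded_linear)
qed

lemma c_embed_mult: "c_embed b (z * w) = c_scale z (c_embed b w)"
  by (simp add: c_embed_def c_scale_def scaleR_diff_left scaleR_add_left)

lemma c_of_complex_eq_c_embed: "c_of_complex = c_embed 1"
  by (simp add: c_of_complex_def c_embed_def fun_eq_iff)

lemma c_scale_add_right: "c_scale z (v + w) = c_scale z v + c_scale z w"
  by (simp add: c_scale_def scaleR_add_right)

lemma c_holomorphic_on_coord:
  assumes "c_holomorphic_on F D"
  shows "(\<lambda>z. c_coord b (F z)) holomorphic_on D"
  unfolding holomorphic_on_def field_differentiable_def
proof
  fix z assume "z \<in> D"
  then obtain w where "(F has_derivative (\<lambda>h. c_scale h w)) (at z within D)"
    using assms by (auto simp: c_holomorphic_on_def)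
  hence "((\<lambda>z. c_coord b (F z)) has_derivative (\<lambda>h. c_coord b (c_scale h w))) (at z within D)"
    by (rule bounded_linear.has_derivative[OF bounded_linear_c_coord])
  hence "((\<lambda>z. c_coord b (F z)) has_field_derivative c_coord b w) (at z within D)"
    by (simp add: has_field_derivative_def c_coord_c_scale mult.commute[of "c_coord b w"] mult_commute_abs)
  thus "\<exists>f'. ((\<lambda>z. c_coord b (F z)) has_field_derivative f') (at z within D)" by blast
qed

lemma c_holomorphic_on_c_embed:
  assumes "h holomorphic_on D"
  shows "c_holomorphic_on (\<lambda>z. c_embed b (h z)) D"
  unfolding c_holomorphic_on_def
proof
  fix z assume "z \<in> D"
  then obtain h' where "(h has_field_derivative h') (at z within D)"
    using assms by (auto simp: holomorphic_on_def field_differentiable_def)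
  hence "((\<lambda>z. c_embed b (h z)) has_derivative (\<lambda>t. c_embed b (h' * t))) (at z within D)"
    unfolding has_field_derivative_def by (rule bounded_linear.has_derivative[OF bounded_linear_c_embed])
  hence "((\<lambda>z. c_embed b (h z)) has_derivative (\<lambda>t. c_scale t (c_embed b h'))) (at z within D)"
    by (simp add: mult.commute[of h'] c_embed_mult)
  thus "\<exists>w. ((\<lambda>z. c_embed b (h z)) has_derivative (\<lambda>t. c_scale t w)) (at z within D)" by blast
qed

lemma c_holomorphic_on_add:
  assumes "c_holomorphic_on F D" "c_holomorphic_on G D"
  shows "c_holomorphic_on (\<lambda>z. F z + G z) D"
  unfolding c_holomorphic_on_def
proof
  fix z assume z: "z \<in> D"
  obtain v where v: "(F has_derivative (\<lambda>h. c_scale h v)) (at z within D)"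
    using assms(1) z by (auto simp: c_holomorphic_on_def)
  obtain w where w: "(G has_derivative (\<lambda>h. c_scale h w)) (at z within D)"
    using assms(2) z by (auto simp: c_holomorphic_on_def)
  have "((\<lambda>z. F z + G z) has_derivative (\<lambda>h. c_scale h (v + w))) (at z within D)"
    using has_derivative_add[OF v w] by (simp add: c_scale_add_right)
  thus "\<exists>w. ((\<lambda>z. F z + G z) has_derivative (\<lambda>h. c_scale h w)) (at z within D)" by blast
qed

lemma c_coord_c_embed:
  assumes "b \<in> Basis" "b' \<in> Basis"
  shows "c_coord b (c_embed b' z) = (if b = b' then z else 0)"
  using assms by (simp add: c_coord_def c_embed_def inner_Basis complex_eq_iff)

lemma c_coord_c_bar: "c_coord b (c_bar w) = cnj (c_coord b w)"
  by (simp add: c_coord_def c_bar_def complex_eq_iff)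

lemma c_bar_c_embed: "c_bar (c_embed b z) = c_embed b (cnj z)"
  by (simp add: c_bar_def c_embed_def)

lemma c_bar_add: "c_bar (v + w) = c_bar v + c_bar w"
  by (simp add: c_bar_def)

text \<open>The sum is the complex bilinear extension of the inner product, evaluated at w twice; no
  conjugation occurs.\<close>

lemma Re_sum_c_coord_squared:
  "Re (\<Sum>b\<in>Basis. (c_coord b w)\<^sup>2) = inner (fst w) (fst w) - inner (snd w) (snd w)"
  "Im (\<Sum>b\<in>Basis. (c_coord b w)\<^sup>2) = 2 * inner (fst w) (snd w)"
proof -
  show "Re (\<Sum>b\<in>Basis. (c_coord b w)\<^sup>2) = inner (fst w) (fst w) - inner (snd w) (snd w)"
    by (subst euclidean_inner[of "fst w" "fst w"], subst euclidean_inner[of "snd w" "snd w"])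
       (simp add: c_coord_def power2_eq_square sum_subtractf)
  show "Im (\<Sum>b\<in>Basis. (c_coord b w)\<^sup>2) = 2 * inner (fst w) (snd w)"
    by (subst euclidean_inner[of "fst w" "snd w"])
       (simp add: c_coord_def power2_eq_square sum_distrib_left algebra_simps)
qed

section \<open>Slice functions and their stem functions\<close>

locale stem_domain = composition_algebra dim_type
  for dim_type :: "'a::hypercomplex itself" +
  fixes D :: "complex set"
  assumes domain: "conj_invariant_open D"
begin

lemma cnj_mem: "z \<in> D \<Longrightarrow> cnj z \<in> D"
  using domain by (auto simp: conj_invariant_open_def)

lemma imag_unit_exists: "\<exists>I :: 'a. I \<in> imag_units"
  using frame_exists Basis_imag_units by metis

lemma stem_real:
  assumes "stem_function D (F :: complex \<Rightarrow> 'a complexified)" "z \<in> D" "Im z = 0"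
  shows "snd (F z) = 0"
proof -
  have "cnj z = z" using assms(3) by (simp add: complex_eq_iff)
  hence "F z = c_bar (F z)" using assms(1,2) by (metis stem_function_def)
  hence "snd (F z) = - snd (F z)" by (metis c_bar_def snd_conv)
  hence "2 *\<^sub>R snd (F z) = 0" by (metis add.right_inverse scaleR_2)
  thus ?thesis by simp
qed

text \<open>The inner product with 1 isolates \<open>\<alpha>\<close>, and norms give
  \<open>\<beta>\<close> up to sign. What stays free is the unit at \<open>\<beta> = 0\<close> and a
  joint change of sign.\<close>

lemma representation_unique:
  assumes "\<alpha> *\<^sub>R 1 + \<beta> *\<^sub>R I = \<alpha>' *\<^sub>R 1 + \<beta>' *\<^sub>R (J :: 'a)" "I \<in> imag_units" "J \<in> imag_units"
  shows "\<alpha> = \<alpha>'" "(\<beta> = \<beta>' \<and> (\<beta> = 0 \<or> I = J)) \<or> (\<beta> = - \<beta>' \<and> I = - J)"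
proof -
  have I: "inner I 1 = 0" "inner I I = 1" and J: "inner J 1 = 0" "inner J J = 1"
    using assms(2,3) by (auto simp: imag_units_iff)
  have "inner (\<alpha> *\<^sub>R 1 + \<beta> *\<^sub>R I) 1 = inner (\<alpha>' *\<^sub>R 1 + \<beta>' *\<^sub>R J) 1" by (simp only: assms(1))
  thus a: "\<alpha> = \<alpha>'" using I J inner_one_one by (simp add: inner_add_left)
  hence b: "\<beta> *\<^sub>R I = \<beta>' *\<^sub>R J" using assms(1) by simp
  have "inner (\<beta> *\<^sub>R I) (\<beta> *\<^sub>R I) = inner (\<beta>' *\<^sub>R J) (\<beta>' *\<^sub>R J)" by (simp only: b)
  hence "\<beta>\<^sup>2 = \<beta>'\<^sup>2" using I J by (simp add: power2_eq_square)
  hence "\<beta> = \<beta>' \<or> \<beta> = - \<beta>'" by (simp add: power2_eq_iff)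
  thus "(\<beta> = \<beta>' \<and> (\<beta> = 0 \<or> I = J)) \<or> (\<beta> = - \<beta>' \<and> I = - J)"
  proof
    assume "\<beta> = \<beta>'"
    thus ?thesis using b by auto
  next
    assume *: "\<beta> = - \<beta>'"
    show ?thesis
    proof (cases "\<beta>' = 0")
      case False
      have "\<beta>' *\<^sub>R (- I) = \<beta>' *\<^sub>R J" using b * by simp
      hence "- I = J" using False by (metis scaleR_cancel_left)
      thus ?thesis using * by auto
    qed (use * in simp)
  qed
qed

text \<open>Shows that the definite description is well defined: at real points the second component
  vanishes, and a joint change of sign of \<open>\<beta>\<close> and I is compensated by
  \<open>c_bar\<close>.\<close>

lemma induced_eq:
  assumes F: "stem_function D (F :: complex \<Rightarrow> 'a complexified)" and D: "Complex \<alpha> \<beta> \<in> D"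
    and I: "I \<in> imag_units"
  shows "induced F (\<alpha> *\<^sub>R 1 + \<beta> *\<^sub>R I) = fst (F (Complex \<alpha> \<beta>)) + I * snd (F (Complex \<alpha> \<beta>))"
proof -
  let ?v = "fst (F (Complex \<alpha> \<beta>)) + I * snd (F (Complex \<alpha> \<beta>))"
  have "fst (F (Complex \<alpha>' \<beta>')) + J * snd (F (Complex \<alpha>' \<beta>')) = ?v"
    if J: "J \<in> imag_units" "\<alpha> *\<^sub>R 1 + \<beta> *\<^sub>R I = \<alpha>' *\<^sub>R 1 + \<beta>' *\<^sub>R J" for \<alpha>' \<beta>' J
    using representation_unique(2)[OF J(2) I J(1)]
  proof (elim disjE conjE)
    assume *: "\<beta> = \<beta>'" "\<beta> = 0"
    have "snd (F (Complex \<alpha> \<beta>)) = 0" using stem_real[OF F D] * by simp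
    thus ?thesis using * representation_unique(1)[OF J(2) I J(1)] by (simp add: bilinear_simps)
  next
    assume "\<beta> = \<beta>'" "I = J"
    thus ?thesis using representation_unique(1)[OF J(2) I J(1)] by simp
  next
    assume *: "\<beta> = - \<beta>'" "I = - J"
    have "Complex \<alpha>' \<beta>' = cnj (Complex \<alpha> \<beta>)"
      using * representation_unique(1)[OF J(2) I J(1)] by (simp add: complex_eq_iff)
    hence "F (Complex \<alpha>' \<beta>') = c_bar (F (Complex \<alpha> \<beta>))"
      using F D by (simp add: stem_function_def)
    thus ?thesis using * by (simp add: c_bar_def bilinear_simps)
  qed
  hence *: "\<forall>\<alpha>' \<beta>' J. J \<in> imag_units \<and> \<alpha> *\<^sub>R 1 + \<beta> *\<^sub>R I = \<alpha>' *\<^sub>R 1 + \<beta>' *\<^sub>R J \<longrightarrow>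
      ?v = fst (F (Complex \<alpha>' \<beta>')) + J * snd (F (Complex \<alpha>' \<beta>'))"
    by metis
  show ?thesis unfolding induced_def
  proof (rule the_equality)
    fix y assume "\<forall>\<alpha>' \<beta>' J. J \<in> imag_units \<and> \<alpha> *\<^sub>R 1 + \<beta> *\<^sub>R I = \<alpha>' *\<^sub>R 1 + \<beta>' *\<^sub>R J \<longrightarrow>
      y = fst (F (Complex \<alpha>' \<beta>')) + J * snd (F (Complex \<alpha>' \<beta>'))"
    with I show "y = ?v" by blast
  qed (rule *)
qed

lemma circularizationE:
  assumes "x \<in> circularization D"
  obtains \<alpha> \<beta> and I :: 'a where "x = \<alpha> *\<^sub>R 1 + \<beta> *\<^sub>R I" "Complex \<alpha> \<beta> \<in> D" "I \<in> imag_units"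
  using assms by (auto simp: circularization_def)

lemma is_stem_of_eq:
  assumes "is_stem_of D F (f :: 'a \<Rightarrow> 'a)" "Complex \<alpha> \<beta> \<in> D" "I \<in> imag_units"
  shows "f (\<alpha> *\<^sub>R 1 + \<beta> *\<^sub>R I) = fst (F (Complex \<alpha> \<beta>)) + I * snd (F (Complex \<alpha> \<beta>))"
proof -
  have "\<alpha> *\<^sub>R 1 + \<beta> *\<^sub>R I \<in> circularization D"
    using assms(2,3) by (auto simp: circularization_def)
  thus ?thesis using assms(1) induced_eq[of F, OF _ assms(2,3)] by (simp add: is_stem_of_def)
qed

text \<open>Evaluation at I and at -I separates the two components; left multiplication by I is
  injective because applying it twice gives a minus sign.\<close>

lemma is_stem_of_unique:
  assumes "is_stem_of D F f" "is_stem_of D G (f :: 'a \<Rightarrow> 'a)" "z \<in> D"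
  shows "F z = G z"
proof -
  obtain \<alpha> \<beta> where z: "z = Complex \<alpha> \<beta>" by (cases z)
  obtain I :: 'a where I: "I \<in> imag_units" using imag_unit_exists by blast
  define a where "a = fst (F z) - fst (G z)"
  define b where "b = snd (F z) - snd (G z)"
  have "a + J * b = 0" if "J \<in> imag_units" for J
    using is_stem_of_eq[OF assms(1), of \<alpha> \<beta> J] is_stem_of_eq[OF assms(2), of \<alpha> \<beta> J] assms(3) that z
    by (simp add: a_def b_def bilinear_simps algebra_simps)
  from this[OF I] this[OF uminus_imag_units[OF I]] have "a + I * b = 0" "a - I * b = 0"
    by (simp_all add: bilinear_simps)
  hence "a = 0" "I * b = 0"
  proof -
    have "2 *\<^sub>R a = (a + I * b) + (a - I * b)" by (simp add: scaleR_2)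
    also have "\<dots> = 0" using \<open>a + I * b = 0\<close> \<open>a - I * b = 0\<close> by simp
    finally show "a = 0" by simp
    thus "I * b = 0" using \<open>a + I * b = 0\<close> by simp
  qed
  hence "b = 0" using imag_unit_mult_mult[OF I, of b] by (simp add: bilinear_simps)
  with \<open>a = 0\<close> show ?thesis by (simp add: a_def b_def prod_eq_iff)
qed

lemma stem_of_eq:
  assumes "is_stem_of D F (f :: 'a \<Rightarrow> 'a)" "z \<in> D"
  shows "stem_of D f z = F z"
  unfolding stem_of_def
  by (rule is_stem_of_unique[OF someI[where P = "\<lambda>F. is_stem_of D F f", OF assms(1)] assms])

lemma is_stem_of_induced:
  "stem_function D (F :: complex \<Rightarrow> 'a complexified) \<Longrightarrow> is_stem_of D F (induced F)"
  by (simp add: is_stem_of_def)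

lemma induced_cong:
  assumes "stem_function D F" "stem_function D G" "\<And>z. z \<in> D \<Longrightarrow> F z = G z" "x \<in> circularization D"
  shows "induced F x = induced G (x :: 'a)"
  using assms(4) by (rule circularizationE) (simp add: induced_eq assms)

lemma stem_function_cong:
  assumes "stem_function D F" "\<And>z. z \<in> D \<Longrightarrow> G z = F z"
  shows "stem_function D G"
  using assms cnj_mem by (simp add: stem_function_def)

lemma is_stem_of_cong:
  assumes "is_stem_of D F (f :: 'a \<Rightarrow> 'a)" "\<And>z. z \<in> D \<Longrightarrow> G z = F z"
  shows "is_stem_of D G f"
proof -
  have G: "stem_function D G" using assms by (auto simp: is_stem_of_def intro: stem_function_cong)
  moreover have "induced F x = induced G x" if "x \<in> circularization D" for x :: 'a
    using assms that G by (intro induced_cong) (auto simp: is_stem_of_def)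
  ultimately show ?thesis using assms(1) by (simp add: is_stem_of_def)
qed

lemma stem_function_c_embed:
  assumes "\<And>z. z \<in> D \<Longrightarrow> h (cnj z) = cnj (h z)"
  shows "stem_function D (\<lambda>z. c_embed b (h z))"
  using assms by (simp add: stem_function_def c_bar_c_embed)

lemma is_stem_of_slice_conj:
  assumes "is_stem_of D F (f :: 'a \<Rightarrow> 'a)"
  shows "is_stem_of D (\<lambda>z. c_hconj (F z)) (slice_conj D f)"
proof -
  have "c_hconj (c_bar w) = c_bar (c_hconj w)" for w :: "'a complexified"
    by (simp add: c_hconj_def c_bar_def hconj_eq algebra_simps)
  hence F: "stem_function D (\<lambda>z. c_hconj (F z))"
    using assms by (simp add: is_stem_of_def stem_function_def)
  \<comment> \<open>\<open>slice_conj\<close> is built from \<open>stem_of\<close>, a choice that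
    agrees with F only on D.\<close>
  hence "stem_function D (\<lambda>z. c_hconj (stem_of D f z))"
    by (rule stem_function_cong) (simp add: stem_of_eq[OF assms])
  from is_stem_of_cong[OF is_stem_of_induced[OF this]] show ?thesis
    unfolding slice_conj_def by (simp add: stem_of_eq[OF assms])
qed

lemma slice_trace_eq:
  assumes F: "is_stem_of D F (f :: 'a \<Rightarrow> 'a)" and z: "Complex \<alpha> \<beta> \<in> D" and I: "I \<in> imag_units"
  shows "slice_trace D f (\<alpha> *\<^sub>R 1 + \<beta> *\<^sub>R I) =
    (2 * Re (c_coord 1 (F (Complex \<alpha> \<beta>)))) *\<^sub>R 1 + (2 * Im (c_coord 1 (F (Complex \<alpha> \<beta>)))) *\<^sub>R I"
  unfolding slice_trace_def is_stem_of_eq[OF F z I] is_stem_of_eq[OF is_stem_of_slice_conj[OF F] z I]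
  by (simp add: c_hconj_def hconj_eq c_coord_def bilinear_simps)

text \<open>The diagonal terms come from \<open>mult_hconj\<close> and the mixed ones from its
  polarization. Hence the norm of a slice function sees its stem only through a sum of
  squares.\<close>

lemma c_mult_c_hconj: "c_mult w (c_hconj w) = c_embed (1 :: 'a) (\<Sum>b\<in>Basis. (c_coord b w)\<^sup>2)"
  by (simp only: c_embed_def Re_sum_c_coord_squared)
     (simp add: c_mult_def c_hconj_def mult_hconj mult_hconj_sym algebra_simps)

lemma slice_norm_eq:
  assumes F: "is_stem_of D F (f :: 'a \<Rightarrow> 'a)" and z: "Complex \<alpha> \<beta> \<in> D" and I: "I \<in> imag_units"
  shows "slice_norm D f (\<alpha> *\<^sub>R 1 + \<beta> *\<^sub>R I) =
    Re (\<Sum>b\<in>Basis. (c_coord b (F (Complex \<alpha> \<beta>)))\<^sup>2) *\<^sub>R 1 +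
    Im (\<Sum>b\<in>Basis. (c_coord b (F (Complex \<alpha> \<beta>)))\<^sup>2) *\<^sub>R I"
proof -
  let ?N = "\<lambda>z. c_embed (1 :: 'a) (\<Sum>b\<in>Basis. (c_coord b (F z))\<^sup>2)"
  have "stem_function D ?N"
    using F by (intro stem_function_c_embed) (simp add: is_stem_of_def stem_function_def c_coord_c_bar)
  hence *: "stem_function D (\<lambda>z. c_mult (stem_of D f z) (stem_of D (slice_conj D f) z))"
    by (rule stem_function_cong)
       (simp add: stem_of_eq[OF F] stem_of_eq[OF is_stem_of_slice_conj[OF F]] c_mult_c_hconj)
  show ?thesis
    unfolding slice_norm_def slice_times_def induced_eq[OF * z I]
    unfolding stem_of_eq[OF F z] stem_of_eq[OF is_stem_of_slice_conj[OF F] z] c_mult_c_hconj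
    by (simp add: c_embed_def bilinear_simps)
qed

lemma simply_connected_upper_half:
  assumes "basic_domain (circularization D :: 'a set)"
  shows "simply_connected (D \<inter> {z. 0 < Im z})"
proof -
  obtain J :: 'a where J: "J \<in> imag_units" using imag_unit_exists by blast
  define \<phi> where "\<phi> = (\<lambda>z. Re z *\<^sub>R 1 + Im z *\<^sub>R J)"
  have lin: "linear \<phi>"
    by (rule linearI) (simp_all add: \<phi>_def algebra_simps)
  have inj: "inj \<phi>"
  proof (rule injI)
    fix z w assume "\<phi> z = \<phi> w"
    hence *: "Re z *\<^sub>R 1 + Im z *\<^sub>R J = Re w *\<^sub>R 1 + Im w *\<^sub>R J" by (simp add: \<phi>_def)
    have "J \<noteq> - J"
    proof
      assume "J = - J"
      hence "2 *\<^sub>R J = 0" by (metis add.right_inverse scaleR_2)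
      thus False using J by (simp add: imag_units_iff)
    qed
    with representation_unique[OF * J J] show "z = w" by (auto simp: complex_eq_iff)
  qed
  have "\<phi> ` (D \<inter> {z. 0 < Im z}) = circularization D \<inter> upper_half_slice J"
  proof (intro equalityI subsetI)
    fix x assume "x \<in> \<phi> ` (D \<inter> {z. 0 < Im z})"
    then obtain z where z: "z \<in> D" "0 < Im z" "x = Re z *\<^sub>R 1 + Im z *\<^sub>R J"
      by (auto simp: \<phi>_def)
    have "x \<in> circularization D"
      unfolding circularization_def mem_Collect_eq
      by (intro exI[of _ "Re z"] exI[of _ "Im z"] exI[of _ J]) (simp add: z J)
    moreover have "x \<in> upper_half_slice J"
      unfolding upper_half_slice_def using z by blast
    ultimately show "x \<in> circularization D \<inter> upper_half_slice J" by blast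
  next
    fix x assume x: "x \<in> circularization D \<inter> upper_half_slice J"
    then obtain \<alpha> \<beta> and I :: 'a where 1: "x = \<alpha> *\<^sub>R 1 + \<beta> *\<^sub>R I" "Complex \<alpha> \<beta> \<in> D" "I \<in> imag_units"
      using circularizationE by blast
    from x obtain \<alpha>' \<beta>' where 2: "x = \<alpha>' *\<^sub>R 1 + \<beta>' *\<^sub>R J" "\<beta>' > 0"
      by (auto simp: upper_half_slice_def)
    have "\<alpha> *\<^sub>R 1 + \<beta> *\<^sub>R I = \<alpha>' *\<^sub>R 1 + \<beta>' *\<^sub>R J" using 1 2 by simp
    from representation_unique[OF this 1(3) J]
    \<comment> \<open>The given representation may use -J with a negative coefficient; then the
      point of D is the conjugate one.\<close>
    have "Complex \<alpha>' \<beta>' = Complex \<alpha> \<beta> \<or> Complex \<alpha>' \<beta>' = cnj (Complex \<alpha> \<beta>)"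
      by (auto simp: complex_eq_iff)
    hence "Complex \<alpha>' \<beta>' \<in> D" using 1(2) cnj_mem by metis
    thus "x \<in> \<phi> ` (D \<inter> {z. 0 < Im z})"
      using 2 by (intro image_eqI[of _ _ "Complex \<alpha>' \<beta>'"]) (auto simp: \<phi>_def)
  qed
  moreover have "simply_connected (circularization D \<inter> upper_half_slice J)"
    using assms J by (simp add: basic_domain_def)
  moreover have "(D \<inter> {z. 0 < Im z}) homeomorphic \<phi> ` (D \<inter> {z. 0 < Im z})"
    by (rule homeomorphic_sym[THEN iffD1], rule linear_homeomorphic_image[OF lin inj, THEN homeomorphic_sym[THEN iffD1]])
  ultimately show ?thesis
    using homeomorphic_simply_connected_eq by metis
qed

theorem strongly_equivalent_two_components:
  fixes f :: "'a \<Rightarrow> 'a"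
  assumes basic: "basic_domain (circularization D :: 'a set)" and f: "f \<in> slice_regular D"
  shows "\<exists>H0 i j h1 h2.
           quaternionic_frame H0 i j \<and>
           h1 \<in> slice_preserving_regular D \<and> h2 \<in> slice_preserving_regular D \<and>
           (let f' = (\<lambda>x. real_part D f x + h1 x * i + h2 x * j)
            in f' \<in> slice_regular D \<and> strongly_equivalent D f' f)"
proof -
  interpret reflected_domain D
    using domain simply_connected_upper_half[OF basic]
    by unfold_locales (auto simp: conj_invariant_open_def)
  obtain F where F: "is_stem_of D F f" "c_holomorphic_on F D"
    using f by (auto simp: slice_regular_def)
  have refl: "reflective (\<lambda>z. c_coord b (F z))" for b
    unfolding reflective_def using c_holomorphic_on_coord[OF F(2)] F(1)
    by (simp add: is_stem_of_def stem_function_def c_coord_c_bar)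
  obtain i j :: 'a where ij: "i \<in> Basis - {1}" "j \<in> Basis - {1}" "i \<noteq> j"
    "quaternionic_frame (span {1, i, j, i * j}) i j"
    by (rule frame_exists)
  have basis: "i \<in> Basis" "j \<in> Basis" "i \<noteq> 1" "j \<noteq> 1" "1 \<noteq> i" "1 \<noteq> j" "j \<noteq> i" using ij by auto
  obtain H1 H2 where H: "reflective H1" "reflective H2"
    "\<And>z. z \<in> D \<Longrightarrow> (H1 z)\<^sup>2 + (H2 z)\<^sup>2 = (\<Sum>b\<in>Basis - {1 :: 'a}. (c_coord b (F z))\<^sup>2)"
    "\<And>p. p \<in> D \<Longrightarrow> min (holo_order H1 p) (holo_order H2 p) =
      Min ((\<lambda>b. holo_order (\<lambda>z. c_coord b (F z)) p) ` (Basis - {1 :: 'a}))"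
  proof (rule sum_of_two_squares[of "Basis - {1 :: 'a}" "\<lambda>b z. c_coord b (F z)"])
    show "Basis - {1 :: 'a} \<noteq> {}" using ij(1) by blast
  qed (simp_all add: refl)
  define h where "h = (\<lambda>H. induced (\<lambda>z. c_embed (1 :: 'a) (H z)))"
  have stem_h: "stem_function D (\<lambda>z. c_embed (b :: 'a) (H z))" if "reflective H" for H b
    using that by (intro stem_function_c_embed) (simp add: reflective_def)
  have h_stem: "is_stem_of D (\<lambda>z. c_embed 1 (H z)) (h H)" if "reflective H" for H
    unfolding h_def by (rule is_stem_of_induced[OF stem_h[OF that]])
  have h_regular: "h H \<in> slice_preserving_regular D" if "reflective H" for H
  proof -
    have "c_holomorphic_on (\<lambda>z. c_embed (1 :: 'a) (H z)) D"
      using that by (intro c_holomorphic_on_c_embed) (simp add: reflective_def)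
    with h_stem[OF that] show ?thesis
      unfolding slice_preserving_regular_def slice_regular_def
      by (auto simp: stem_of_eq[OF h_stem[OF that]] c_of_complex_eq_c_embed)
  qed
  define F0 where "F0 = (\<lambda>z. c_coord 1 (F z))"
  have F0: "reflective F0" unfolding F0_def by (rule refl)
  define f' where "f' = (\<lambda>x. real_part D f x + h H1 x * i + h H2 x * j)"
  define F' where "F' = (\<lambda>z. c_embed 1 (F0 z) + c_embed i (H1 z) + c_embed j (H2 z))"
  have real_part: "real_part D f x = h F0 x" if "x \<in> circularization D" for x
    unfolding real_part_def h_def c_of_complex_eq_c_embed
  proof (rule induced_cong[OF _ stem_h[OF F0] _ that])
    show *: "c_embed 1 (stem_coord D f 1 z) = c_embed (1 :: 'a) (F0 z)" if "z \<in> D" for z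
      using that by (simp add: stem_coord_def stem_of_eq[OF F(1)] F0_def)
    show "stem_function D (\<lambda>z. c_embed (1 :: 'a) (stem_coord D f 1 z))"
      by (rule stem_function_cong[OF stem_h[OF F0, of 1]]) (simp only: *)
  qed
  have F'_stem: "stem_function D F'"
    using stem_h[OF F0, of 1] stem_h[OF H(1), of i] stem_h[OF H(2), of j]
    by (simp add: stem_function_def F'_def c_bar_add)
  have "f' x = induced F' x" if x: "x \<in> circularization D" for x
    using x
  proof (rule circularizationE)
    fix \<alpha> \<beta> and I :: 'a assume *: "x = \<alpha> *\<^sub>R 1 + \<beta> *\<^sub>R I" "Complex \<alpha> \<beta> \<in> D" "I \<in> imag_units"
    have "f' x = h F0 x + h H1 x * i + h H2 x * j"
      using real_part[OF x] by (simp add: f'_def)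
    \<comment> \<open>The pointwise products with i and j agree with the slice products: the stems
      of \<open>h H1\<close> and \<open>h H2\<close> are real multiples of 1 in both components, so
      no associativity is involved.\<close>
    also have "\<dots> = induced F' x"
      unfolding *(1) is_stem_of_eq[OF h_stem[OF F0] *(2,3)] is_stem_of_eq[OF h_stem[OF H(1)] *(2,3)]
        is_stem_of_eq[OF h_stem[OF H(2)] *(2,3)] induced_eq[OF F'_stem *(2,3)]
      by (simp add: F'_def c_embed_def bilinear_simps)
    finally show ?thesis .
  qed
  hence f'_stem: "is_stem_of D F' f'" using F'_stem by (simp add: is_stem_of_def)
  have "c_holomorphic_on F' D"
    unfolding F'_def using F0 H(1,2)
    by (intro c_holomorphic_on_add c_holomorphic_on_c_embed) (simp_all add: reflective_def)
  with f'_stem have regular: "f' \<in> slice_regular D" by (auto simp: slice_regular_def)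
  have coord: "c_coord b (F' z) = (if b = 1 then F0 z else if b = i then H1 z else if b = j then H2 z else 0)"
    if "b \<in> Basis" for b z
    using that basis ij(3) one_Basis by (simp add: F'_def c_coord_add c_coord_c_embed)
  have norm_eq: "(\<Sum>b\<in>Basis. (c_coord b (F' z))\<^sup>2) = (\<Sum>b\<in>Basis. (c_coord b (F z))\<^sup>2)" if z: "z \<in> D" for z
  proof -
    have "(\<Sum>b\<in>Basis. (c_coord b (F' z))\<^sup>2) = (F0 z)\<^sup>2 + (\<Sum>b\<in>Basis - {1}. (c_coord b (F' z))\<^sup>2)"
      using coord[OF one_Basis] by (simp add: sum.remove[OF finite_Basis one_Basis])
    also have "(\<Sum>b\<in>Basis - {1}. (c_coord b (F' z))\<^sup>2) = (\<Sum>b\<in>{i, j}. (c_coord b (F' z))\<^sup>2)"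
      using ij by (intro sum.mono_neutral_right) (auto simp: coord)
    also have "\<dots> = (H1 z)\<^sup>2 + (H2 z)\<^sup>2" using basis ij(3) by (simp add: coord)
    also have "\<dots> = (\<Sum>b\<in>Basis - {1}. (c_coord b (F z))\<^sup>2)" by (rule H(3)[OF z])
    also have "(F0 z)\<^sup>2 + \<dots> = (\<Sum>b\<in>Basis. (c_coord b (F z))\<^sup>2)"
      by (simp add: sum.remove[OF finite_Basis one_Basis] F0_def)
    finally show ?thesis .
  qed
  have stem_coord_order: "holo_order (stem_coord D g b) p = holo_order (\<lambda>z. c_coord b (G z)) p"
    if "is_stem_of D G g" "p \<in> D" for G and g :: "'a \<Rightarrow> 'a" and b p
  proof (rule holo_order_cong)
    show "\<forall>\<^sub>F z in nhds p. stem_coord D g b z = c_coord b (G z)"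
      using nhds_D[OF that(2)] by eventually_elim (simp add: stem_coord_def stem_of_eq[OF that(1)])
  qed
  have "cdiv D f' p = cdiv D f p" for p
  proof (cases "p \<in> D")
    case p: True
    have "Min ((\<lambda>b. holo_order (\<lambda>z. c_coord b (F' z)) p) ` (Basis - {1})) =
      min (holo_order H1 p) (holo_order H2 p)"
    proof (rule Min_eqI)
      fix y assume "y \<in> (\<lambda>b. holo_order (\<lambda>z. c_coord b (F' z)) p) ` (Basis - {1})"
      then obtain b where b: "b \<in> Basis" "b \<noteq> 1" "y = holo_order (\<lambda>z. c_coord b (F' z)) p" by blast
      consider "b = i" | "b = j" | "b \<noteq> i" "b \<noteq> j" by blast
      thus "min (holo_order H1 p) (holo_order H2 p) \<le> y"
      proof cases
        case 3
        \<comment> \<open>The remaining coordinates vanish identically; their infinite order does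
          not affect the minimum.\<close>
        hence "y = holo_order (\<lambda>_. 0) p" using b by (simp add: coord)
        thus ?thesis by (simp add: holo_order_def)
      qed (use b basis ij(3) in \<open>simp_all add: coord\<close>)
    next
      have "holo_order H1 p = holo_order (\<lambda>z. c_coord i (F' z)) p"
        "holo_order H2 p = holo_order (\<lambda>z. c_coord j (F' z)) p"
        using basis ij(3) by (simp_all add: coord)
      thus "min (holo_order H1 p) (holo_order H2 p) \<in>
          (\<lambda>b. holo_order (\<lambda>z. c_coord b (F' z)) p) ` (Basis - {1})"
        using ij(1,2) unfolding min_def by auto
    qed simp
    thus ?thesis
      using p H(4)[OF p] by (simp add: cdiv_def stem_coord_order[OF f'_stem p] stem_coord_order[OF F(1) p])
  qed (simp add: cdiv_def)
  hence "cdiv D f' = cdiv D f" by blast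
  moreover have "slice_trace D f' x = slice_trace D f x \<and> slice_norm D f' x = slice_norm D f x"
    if "x \<in> circularization D" for x
    using that
  proof (rule circularizationE)
    fix \<alpha> \<beta> and I :: 'a assume *: "x = \<alpha> *\<^sub>R 1 + \<beta> *\<^sub>R I" "Complex \<alpha> \<beta> \<in> D" "I \<in> imag_units"
    have "c_coord 1 (F' z) = c_coord 1 (F z)" for z
      using coord[OF one_Basis] by (simp add: F0_def)
    thus ?thesis
      unfolding *(1) slice_trace_eq[OF f'_stem *(2,3)] slice_trace_eq[OF F(1) *(2,3)]
        slice_norm_eq[OF f'_stem *(2,3)] slice_norm_eq[OF F(1) *(2,3)] norm_eq[OF *(2)]
      by simp
  qed
  ultimately have "strongly_equivalent D f' f" by (simp add: strongly_equivalent_def)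
  with regular ij(4) h_regular[OF H(1)] h_regular[OF H(2)] show ?thesis
    unfolding Let_def f'_def by blast
qed

end

theorem proposition4p19:
  fixes D :: "complex set"
  assumes "conj_invariant_open D"
  shows
    "(\<forall>f :: quat \<Rightarrow> quat.
        basic_domain (circularization D :: quat set) \<and> f \<in> slice_regular D \<longrightarrow>
        (\<exists>H0 i j h1 h2.
           quaternionic_frame H0 i j \<and>
           h1 \<in> slice_preserving_regular D \<and> h2 \<in> slice_preserving_regular D \<and>
           (let f' = (\<lambda>x. real_part D f x + h1 x * i + h2 x * j)
            in f' \<in> slice_regular D \<and> strongly_equivalent D f' f))) \<and>
     (\<forall>f :: octo \<Rightarrow> octo.
        basic_domain (circularization D :: octo set) \<and> f \<in> slice_regular D \<longrightarrow>
        (\<exists>H0 i j h1 h2.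
           quaternionic_frame H0 i j \<and>
           h1 \<in> slice_preserving_regular D \<and> h2 \<in> slice_preserving_regular D \<and>
           (let f' = (\<lambda>x. real_part D f x + h1 x * i + h2 x * j)
            in f' \<in> slice_regular D \<and> strongly_equivalent D f' f)))"
proof -
  interpret quat_domain: stem_domain "TYPE(quat)" D by unfold_locales (rule assms)
  interpret octo_domain: stem_domain "TYPE(octo)" D by unfold_locales (rule assms)
  show ?thesis
    using quat_domain.strongly_equivalent_two_components octo_domain.strongly_equivalent_two_components
    by blast
qed

end
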